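(* Let $n\ge1$ and let $\mathbf c=(c_1,\dots,c_n)$ be a weak composition (a sequence of nonnegative integers, regarded as an $\mathbb{N}$-vector with $c_i=0$ for $i>n$). Then the reduction of $\mathfrak{P}_{\mathbf c}$ modulo $\mathrm{QSym}_n^+$, i.e. the unique element of $\mathbb{Q}\{\mathbf x^{\mathbf d}:\mathbf d\in\mathrm{ABB}_n\}$ congruent to $\mathfrak{P}_{\mathbf c}$, equals $\mathfrak{P}_{\mathbf c}$ if $\mathbf c\in\mathrm{ABB}_n$ and $0$ if $\mathbf c\notin\mathrm{ABB}_n$.
   Context: Indexed forests: for finite $S\subset\mathbb{Z}_{\ge1}$ with maximal consecutive blocks $I_1<\cdots<I_k$, an indexed forest $F$ with support $S$ consists of plane binary trees $T_j$ with $|I_j|$ nodes, canonically labeled by $I_j$ in inorder. Missing children are leaves. $\rho_F(v)$ is the canonical label of the node reached from $v$ by following left children as long as possible. $\mathbf c(F)=(c_i)$ with $c_i=\#\{v:\rho_F(v)=i\}$; the map $F\mapsto\mathbf c(F)$ is a bijection from such forests onto $\mathbb{N}$-vectors, and $\mathfrak{P}_{\mathbf c}:=\mathfrak{P}_F$ for $\mathbf c(F)=\mathbf c$. Here $\mathfrak{P}_F=\sum_\kappa\prod_v x_{\kappa(v)}$ over $\kappa:\operatorname{IN}(F)\to\mathbb{Z}_{\ge1}$ with $\kappa(v)\le\rho_F(v)$, $\kappa(\text{left child of }u)\ge\kappa(u)$, and $\kappa(\text{right child of }u)>\kappa(u)$. $\mathrm{QSym}_n^+$ is the ideal of $\mathbb{Q}[x_1,\dots,x_n]$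 generated by the positive-degree quasisymmetric polynomials in $x_1,\dots,x_n$. $\mathrm{ABB}_n$ is the set of weak compositions $(c_1,\dots,c_n)$ with $\sum_{i=1}^{j}c_{n+1-i}\le j-1$ for $j=1,\dots,n$, and $\mathbf x^{\mathbf d}=\prod_i x_i^{d_i}$. By Aval–Bergeron–Bergeron, $\mathbb{Q}[x_1,\dots,x_n]=\mathbb{Q}\{\mathbf x^{\mathbf d}:\mathbf d\in\mathrm{ABB}_n\}\oplus\mathrm{QSym}_n^+$. *)

theory Defs
  imports Complex_Main "HOL-Library.Tree" "HOL-Library.Poly_Mapping" "HOL-Library.FuncSet"
begin

text \<open>
  Polynomials in the variables \<open>x\<^sub>1, x\<^sub>2, \<dots>\<close> over the rationals are finitely supported functions from
  exponent vectors to coefficients, with the convolution product of \<^theory>\<open>HOL-Library.Poly_Mapping\<close>.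
  Exponent vectors are indexed from 1; a weak composition \<open>(c\<^sub>1, \<dots>, c\<^sub>n)\<close> is an exponent vector
  whose support is contained in \<open>{1..n}\<close>.
\<close>

type_synonym expvec = "nat \<Rightarrow>\<^sub>0 nat"
type_synonym qpoly = "expvec \<Rightarrow>\<^sub>0 rat"

definition monomial :: "expvec \<Rightarrow> qpoly" where
  "monomial d = Poly_Mapping.single d 1"

definition X :: "nat \<Rightarrow> qpoly" where
  "X i = monomial (Poly_Mapping.single i 1)"

definition smult :: "rat \<Rightarrow> qpoly \<Rightarrow> qpoly" where
  "smult r p = Poly_Mapping.single 0 r * p"

global_interpretation qpoly: vector_space smult
  by unfold_locales
    (simp_all add: smult_def algebra_simps single_add mult_single flip: mult.assoc)

definition polys_upto :: "nat \<Rightarrow> qpoly set" where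
  "polys_upto n = {p. \<forall>m\<in>Poly_Mapping.keys p. Poly_Mapping.keys m \<subseteq> {1..n}}"

definition homogeneous :: "nat \<Rightarrow> qpoly \<Rightarrow> bool" where
  "homogeneous d p \<longleftrightarrow>
     (\<forall>m\<in>Poly_Mapping.keys p. (\<Sum>i\<in>Poly_Mapping.keys m. Poly_Mapping.lookup m i) = d)"


section \<open>Quasisymmetric polynomials\<close>

definition quasisymmetric :: "nat \<Rightarrow> qpoly \<Rightarrow> bool" where
  "quasisymmetric n p \<longleftrightarrow> p \<in> polys_upto n \<and>
     (\<forall>(k::nat) (a::nat \<Rightarrow> nat) (i::nat \<Rightarrow> nat) (j::nat \<Rightarrow> nat).
        (\<forall>r<k. a r > 0) \<longrightarrow>
        strict_mono_on {..<k} i \<longrightarrow> i ` {..<k} \<subseteq> {1..n} \<longrightarrow>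
        strict_mono_on {..<k} j \<longrightarrow> j ` {..<k} \<subseteq> {1..n} \<longrightarrow>
        Poly_Mapping.lookup p (\<Sum>r<k. Poly_Mapping.single (i r) (a r)) =
        Poly_Mapping.lookup p (\<Sum>r<k. Poly_Mapping.single (j r) (a r)))"

definition ideal_gen :: "qpoly set \<Rightarrow> qpoly set \<Rightarrow> qpoly set" where
  "ideal_gen R G = {(\<Sum>q\<in>A. h q * q) | A h. finite A \<and> A \<subseteq> G \<and> (\<forall>q\<in>A. h q \<in> R)}"

definition QSym_plus :: "nat \<Rightarrow> qpoly set" where
  "QSym_plus n =
     ideal_gen (polys_upto n) {q. quasisymmetric n q \<and> (\<exists>d>0. homogeneous d q)}"

definition ABB :: "nat \<Rightarrow> expvec set" where
  "ABB n = {c. Poly_Mapping.keys c \<subseteq> {1..n} \<and>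
     (\<forall>j\<in>{1..n}. (\<Sum>i=1..j. Poly_Mapping.lookup c (n + 1 - i)) \<le> j - 1)}"

definition is_reduction :: "nat \<Rightarrow> qpoly \<Rightarrow> qpoly \<Rightarrow> bool" where
  "is_reduction n p r \<longleftrightarrow> r \<in> qpoly.span (monomial ` ABB n) \<and> p - r \<in> QSym_plus n"

definition reduction :: "nat \<Rightarrow> qpoly \<Rightarrow> qpoly" where
  "reduction n p = (THE r. is_reduction n p r)"


section \<open>Indexed forests and forest polynomials\<close>

definition blocks :: "nat set \<Rightarrow> nat set set" where
  "blocks S = {{a..b} | a b. a \<le> b \<and> {a..b} \<subseteq> S \<and> a - 1 \<notin> S \<and> b + 1 \<notin> S}"

text \<open>
  A forest is the set of its trees, each tree carrying its canonical labels. Constructors \<^const>\<open>Node\<close>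
  are the (internal) nodes and \<^const>\<open>Leaf\<close> is a missing child. Canonical labels are distinct, so
  nodes are identified with their labels and \<open>IN(F)\<close> with the support.
\<close>

definition indexed_forest_on :: "nat set \<Rightarrow> nat tree set \<Rightarrow> bool" where
  "indexed_forest_on S F \<longleftrightarrow> finite S \<and> S \<subseteq> {1..} \<and>
     bij_betw set_tree F (blocks S) \<and>
     (\<forall>T\<in>F. inorder T = sorted_list_of_set (set_tree T))"

definition indexed_forest :: "nat tree set \<Rightarrow> bool" where
  "indexed_forest F \<longleftrightarrow> (\<exists>S. indexed_forest_on S F)"

definition IN :: "nat tree set \<Rightarrow> nat set" where
  "IN F = (\<Union>T\<in>F. set_tree T)"

definition left_child :: "nat tree set \<Rightarrow> nat \<Rightarrow> nat \<Rightarrow> bool" where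
  "left_child F u v \<longleftrightarrow>
     (\<exists>T\<in>F. \<exists>l r r'. Node (Node l v r) u r' \<in> subtrees T)"

definition right_child :: "nat tree set \<Rightarrow> nat \<Rightarrow> nat \<Rightarrow> bool" where
  "right_child F u v \<longleftrightarrow>
     (\<exists>T\<in>F. \<exists>l l' r. Node l u (Node l' v r) \<in> subtrees T)"

fun leftmost :: "nat tree \<Rightarrow> nat" where
  "leftmost Leaf = undefined"
| "leftmost (Node Leaf v r) = v"
| "leftmost (Node (Node l u r') v r) = leftmost (Node l u r')"

definition rho :: "nat tree set \<Rightarrow> nat \<Rightarrow> nat" where
  "rho F v = (THE i. \<exists>T\<in>F. \<exists>l r. Node l v r \<in> subtrees T \<and> i = leftmost (Node l v r))"

definition forest_code :: "nat tree set \<Rightarrow> nat \<Rightarrow> nat" where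
  "forest_code F i = card {v \<in> IN F. rho F v = i}"

definition forest_labelings :: "nat tree set \<Rightarrow> (nat \<Rightarrow> nat) set" where
  "forest_labelings F = {\<kappa> \<in> IN F \<rightarrow>\<^sub>E {1..}.
     (\<forall>v\<in>IN F. \<kappa> v \<le> rho F v) \<and>
     (\<forall>u v. left_child F u v \<longrightarrow> \<kappa> v \<ge> \<kappa> u) \<and>
     (\<forall>u v. right_child F u v \<longrightarrow> \<kappa> v > \<kappa> u)}"

definition forest_poly :: "nat tree set \<Rightarrow> qpoly" where
  "forest_poly F = (\<Sum>\<kappa>\<in>forest_labelings F. \<Prod>v\<in>IN F. X (\<kappa> v))"

definition forest_of :: "expvec \<Rightarrow> nat tree set" where
  "forest_of c = (THE F. indexed_forest F \<and> forest_code F = Poly_Mapping.lookup c)"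

definition forest_poly_code :: "expvec \<Rightarrow> qpoly" where
  "forest_poly_code c = forest_poly (forest_of c)"

end

theory Submission
  imports Defs
begin

text \<open>
  Let \<open>R\<^sub>i\<close> set \<open>x\<^sub>i = 0\<close> and shift down the later variables. The operators \<open>T\<^sub>i = (R\<^bsub>i+1\<^esub> - R\<^sub>i) / x\<^sub>i\<close> with
  \<open>1 \<le> i < n\<close> map the ideal for \<open>n\<close> variables to the one for \<open>n - 1\<close> variables and the span of the
  ABB monomials for \<open>n\<close> to the one for \<open>n - 1\<close>. A polynomial killed by all of them is
  quasisymmetric, and by \<open>c\<^sub>n = 0\<close> a combination of ABB monomials is quasisymmetric only if it is
  constant. By induction on \<open>n\<close> the ideal meets the span trivially, so reductions are unique.

  Since \<open>\<kappa> \<le> \<rho>\<close>, the tail sums of an exponent of a forest polynomial are at most those of its code;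
  hence it lies in the span of the ABB monomials if its code is in ABB. Otherwise some tree of the
  forest contains a label \<open>\<ge> n\<close>. Walk through this tree in inorder and lift the upper bound
  \<open>\<kappa>(v) \<le> \<rho>(v)\<close> node by node. The bound is implied by the other conditions when the current node has
  a right child; otherwise raising it from \<open>B\<close> to \<open>B + 1\<close> changes the sum by a multiple of the same kind
  of sum for a smaller tree that still reaches \<open>n\<close>. Once all bounds are lifted, the sum is
  quasisymmetric, so the polynomial of the tree lies in the ideal.
\<close>

abbreviation "lookup \<equiv> Poly_Mapping.lookup"
abbreviation "keys \<equiv> Poly_Mapping.keys"
abbreviation "single \<equiv> Poly_Mapping.single"

subsection \<open>Substitutions that rename or kill variables\<close>

text \<open>The exponent of the monomial obtained from \<open>x^e\<close> by substituting
  \<open>x_(\<sigma> j)\<close> for every \<open>x_j\<close>.\<close>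

definition reindex :: "(nat \<Rightarrow> nat) \<Rightarrow> expvec \<Rightarrow> expvec" where
  "reindex \<sigma> e = (\<Sum>j\<in>keys e. single (\<sigma> j) (lookup e j))"

lemma lookup_reindex:
  assumes "inj \<sigma>"
  shows "lookup (reindex \<sigma> e) (\<sigma> j) = lookup e j"
proof -
  have "lookup (reindex \<sigma> e) (\<sigma> j) = (\<Sum>i\<in>keys e. if i = j then lookup e i else 0)"
    using assms by (auto simp: reindex_def lookup_sum lookup_single when_def inj_eq intro!: sum.cong)
  also have "\<dots> = lookup e j"
    by (simp add: sum.delta in_keys_iff)
  finally show ?thesis .
qed

lemma lookup_reindex_notin_range: "j \<notin> range \<sigma> \<Longrightarrow> lookup (reindex \<sigma> e) j = 0"
  by (auto simp: reindex_def lookup_sum lookup_single when_def intro!: sum.neutral)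

lemma keys_reindex: "inj \<sigma> \<Longrightarrow> keys (reindex \<sigma> e) = \<sigma> ` keys e"
proof (intro equalityI subsetI)
  fix j assume "inj \<sigma>" "j \<in> keys (reindex \<sigma> e)"
  then show "j \<in> \<sigma> ` keys e"
    using lookup_reindex_notin_range[of j \<sigma> e] by (cases "j \<in> range \<sigma>") (auto simp: in_keys_iff lookup_reindex)
qed (auto simp: in_keys_iff lookup_reindex)

lemma reindex_eqI:
  assumes "inj \<sigma>" "\<And>j. lookup d (\<sigma> j) = lookup e j" "\<And>j. j \<notin> range \<sigma> \<Longrightarrow> lookup d j = 0"
  shows "reindex \<sigma> e = d"
proof (rule poly_mapping_eqI)
  fix j show "lookup (reindex \<sigma> e) j = lookup d j"
    using assms by (cases "j \<in> range \<sigma>") (auto simp: lookup_reindex lookup_reindex_notin_range)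
qed

lemma reindex_add:
  assumes "inj \<sigma>"
  shows "reindex \<sigma> (a + b) = reindex \<sigma> a + reindex \<sigma> b"
  using assms by (intro reindex_eqI) (simp_all add: lookup_add lookup_reindex lookup_reindex_notin_range)

lemma reindex_0 [simp]: "reindex \<sigma> 0 = 0"
  by (simp add: reindex_def)

lemma reindex_single [simp]: "reindex \<sigma> (single j a) = single (\<sigma> j) a"
  by (cases "a = 0") (simp_all add: reindex_def)

lemma reindex_sum: "inj \<sigma> \<Longrightarrow> reindex \<sigma> (sum f A) = (\<Sum>x\<in>A. reindex \<sigma> (f x))"
  by (induction A rule: infinite_finite_induct) (simp_all add: reindex_add)

lemma inj_reindex: "inj \<sigma> \<Longrightarrow> inj (reindex \<sigma>)"
  by (rule injI, rule poly_mapping_eqI) (metis lookup_reindex)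

lemma in_range_reindex:
  assumes "inj \<sigma>" "keys d \<subseteq> range \<sigma>"
  shows "d \<in> range (reindex \<sigma>)"
proof -
  have "reindex \<sigma> (Poly_Mapping.map_key \<sigma> d) = d"
    using assms by (intro reindex_eqI) (auto simp: map_key.rep_eq in_keys_iff)
  then show ?thesis by (metis rangeI)
qed

text \<open>For injective \<open>\<sigma>\<close> this is the ring homomorphism that sends
  \<open>X (\<sigma> j)\<close> to \<open>X j\<close> and kills every variable outside the range of
  \<open>\<sigma>\<close>.\<close>

definition pull :: "(nat \<Rightarrow> nat) \<Rightarrow> qpoly \<Rightarrow> qpoly" where
  "pull \<sigma> p = Poly_Mapping.map_key (reindex \<sigma>) p"

lemma lookup_pull: "inj \<sigma> \<Longrightarrow> lookup (pull \<sigma> p) e = lookup p (reindex \<sigma> e)"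
  by (simp add: pull_def map_key.rep_eq inj_reindex)

lemma keys_pull: "inj \<sigma> \<Longrightarrow> keys (pull \<sigma> p) = reindex \<sigma> -` keys p"
  by (simp add: pull_def keys_map_key inj_reindex)

lemma pull_add: "inj \<sigma> \<Longrightarrow> pull \<sigma> (p + q) = pull \<sigma> p + pull \<sigma> q"
  by (simp add: pull_def map_key_plus inj_reindex)

lemma pull_0: "inj \<sigma> \<Longrightarrow> pull \<sigma> 0 = 0"
  by (simp add: pull_def inj_reindex)

lemma pull_sum: "inj \<sigma> \<Longrightarrow> pull \<sigma> (sum f A) = (\<Sum>x\<in>A. pull \<sigma> (f x))"
  by (induction A rule: infinite_finite_induct) (simp_all add: pull_add pull_0)

lemma pull_single_range: "inj \<sigma> \<Longrightarrow> pull \<sigma> (single (reindex \<sigma> e) a) = single e a"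
  by (simp add: pull_def inj_reindex)

lemma pull_single_notin: "inj \<sigma> \<Longrightarrow> d \<notin> range (reindex \<sigma>) \<Longrightarrow> pull \<sigma> (single d a) = 0"
  by (intro poly_mapping_eqI) (auto simp: lookup_pull lookup_single when_def)

lemma keys_plus_expvec: "keys (a + b) = keys a \<union> keys (b :: expvec)"
  by (auto simp: in_keys_iff lookup_add)

text \<open>Exponents cannot cancel: the support of \<open>a + b\<close> is the union of the two
  supports, so it lies in the range of \<open>\<sigma>\<close> only if both do.\<close>

lemma pull_single_mult:
  assumes "inj \<sigma>"
  shows "pull \<sigma> (single a x * single b y) = pull \<sigma> (single a x) * pull \<sigma> (single b y)"
proof (cases "a \<in> range (reindex \<sigma>) \<and> b \<in> range (reindex \<sigma>)")
  case True
  then obtain a' b' where "a = reindex \<sigma> a'" "b = reindex \<sigma> b'" by auto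
  with assms show ?thesis
    by (simp add: mult_single pull_single_range flip: reindex_add)
next
  case False
  then have "a + b \<notin> range (reindex \<sigma>)"
    using in_range_reindex[OF assms] assms
    by (metis Un_subset_iff image_subset_iff keys_plus_expvec keys_reindex rangeE rangeI subsetI)
  with False assms show ?thesis
    by (auto simp: mult_single pull_single_notin)
qed

lemma qpoly_expansion: "(\<Sum>d\<in>keys p. single d (lookup p d)) = p"
proof (rule poly_mapping_eqI)
  fix e
  have "lookup (\<Sum>d\<in>keys p. single d (lookup p d)) e = (\<Sum>d\<in>keys p. if d = e then lookup p d else 0)"
    by (auto simp: lookup_sum lookup_single when_def intro!: sum.cong)
  also have "\<dots> = lookup p e"
    by (simp add: sum.delta in_keys_iff)
  finally show "lookup (\<Sum>d\<in>keys p. single d (lookup p d)) e = lookup p e" .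
qed

lemma pull_mult:
  assumes "inj \<sigma>"
  shows "pull \<sigma> (p * q) = pull \<sigma> p * pull \<sigma> q"
proof -
  let ?P = "\<lambda>d. single d (lookup p d)" and ?Q = "\<lambda>d. single d (lookup q d)"
  have "pull \<sigma> (p * q) = pull \<sigma> ((\<Sum>d\<in>keys p. ?P d) * (\<Sum>e\<in>keys q. ?Q e))"
    by (simp only: qpoly_expansion)
  also have "\<dots> = (\<Sum>d\<in>keys p. pull \<sigma> (?P d)) * (\<Sum>e\<in>keys q. pull \<sigma> (?Q e))"
    using assms by (simp add: sum_product pull_sum pull_single_mult)
  also have "\<dots> = pull \<sigma> p * pull \<sigma> q"
    using assms by (simp add: qpoly_expansion flip: pull_sum)
  finally show ?thesis .
qed

lemma pull_X: "inj \<sigma> \<Longrightarrow> pull \<sigma> (X (\<sigma> j)) = X j"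
  using pull_single_range[of \<sigma> "single j 1" 1] by (simp add: X_def monomial_def)

lemma pull_X_notin:
  assumes "inj \<sigma>" "j \<notin> range \<sigma>"
  shows "pull \<sigma> (X j) = 0"
proof -
  have "single j 1 \<noteq> reindex \<sigma> e" for e
    using assms lookup_reindex_notin_range[of j \<sigma> e] by (metis lookup_single_eq one_neq_zero)
  with assms show ?thesis
    unfolding X_def monomial_def by (intro pull_single_notin) auto
qed

lemma pull_1: "inj \<sigma> \<Longrightarrow> pull \<sigma> 1 = 1"
  using pull_single_range[of \<sigma> 0 1] by simp


subsection \<open>Degrees, variables, and the ideal\<close>

definition total_degree :: "expvec \<Rightarrow> nat" where
  "total_degree m = (\<Sum>i\<in>keys m. lookup m i)"

lemma homogeneous_iff: "homogeneous d p \<longleftrightarrow> (\<forall>m\<in>keys p. total_degree m = d)"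
  by (simp add: homogeneous_def total_degree_def)

lemma total_degree_superset: "finite A \<Longrightarrow> keys m \<subseteq> A \<Longrightarrow> total_degree m = (\<Sum>i\<in>A. lookup m i)"
  unfolding total_degree_def by (rule sum.mono_neutral_left) (auto simp: in_keys_iff)

lemma total_degree_add: "total_degree (a + b) = total_degree a + total_degree b"
  by (simp add: total_degree_superset[of "keys a \<union> keys b"] keys_plus_expvec lookup_add sum.distrib)

lemma total_degree_reindex: "inj \<sigma> \<Longrightarrow> total_degree (reindex \<sigma> e) = total_degree e"
  unfolding total_degree_def
  by (simp add: keys_reindex sum.reindex inj_on_subset lookup_reindex)

lemma homogeneous_mult: "homogeneous a p \<Longrightarrow> homogeneous b q \<Longrightarrow> homogeneous (a + b) (p * q)"
  using keys_mult[of p q] by (fastforce simp: homogeneous_iff total_degree_add)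

lemma homogeneous_sum: "(\<And>x. x \<in> A \<Longrightarrow> homogeneous d (f x)) \<Longrightarrow> homogeneous d (sum f A)"
  using keys_sum[of f A] by (fastforce simp: homogeneous_iff)

lemma homogeneous_X: "homogeneous 1 (X i)"
  by (simp add: homogeneous_iff X_def monomial_def total_degree_def)

lemma homogeneous_1: "homogeneous 0 1"
  by (simp add: homogeneous_iff total_degree_def)

lemma polys_upto_mult: "p \<in> polys_upto n \<Longrightarrow> q \<in> polys_upto n \<Longrightarrow> p * q \<in> polys_upto n"
  using keys_mult[of p q] by (fastforce simp: polys_upto_def keys_plus_expvec)

lemma polys_upto_sum: "(\<And>x. x \<in> A \<Longrightarrow> f x \<in> polys_upto n) \<Longrightarrow> sum f A \<in> polys_upto n"
  using keys_sum[of f A] by (fastforce simp: polys_upto_def)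

lemma polys_upto_add: "p \<in> polys_upto n \<Longrightarrow> q \<in> polys_upto n \<Longrightarrow> p + q \<in> polys_upto n"
  using keys_add[of p q] by (fastforce simp: polys_upto_def)

lemma polys_upto_1: "1 \<in> polys_upto n"
  by (simp add: polys_upto_def)

lemma polys_upto_0: "0 \<in> polys_upto n"
  by (simp add: polys_upto_def)

lemma polys_upto_uminus: "p \<in> polys_upto n \<Longrightarrow> - p \<in> polys_upto n"
  by (simp add: polys_upto_def)

lemma polys_upto_X: "1 \<le> i \<Longrightarrow> i \<le> n \<Longrightarrow> X i \<in> polys_upto n"
  by (simp add: polys_upto_def X_def monomial_def)

lemma polys_upto_prod: "(\<And>x. x \<in> A \<Longrightarrow> f x \<in> polys_upto n) \<Longrightarrow> prod f A \<in> polys_upto n"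
  by (induction A rule: infinite_finite_induct) (auto simp: polys_upto_1 polys_upto_mult)

section \<open>The ideal generated by quasisymmetric polynomials of positive degree\<close>

lemma ideal_gen_mult:
  assumes mult: "\<And>p q. p \<in> R \<Longrightarrow> q \<in> R \<Longrightarrow> p * q \<in> R" and "g \<in> R" "f \<in> ideal_gen R G"
  shows "g * f \<in> ideal_gen R G"
proof -
  from assms obtain A h where "finite A" "A \<subseteq> G" "\<forall>q\<in>A. h q \<in> R" "f = (\<Sum>q\<in>A. h q * q)"
    by (auto simp: ideal_gen_def)
  then show ?thesis
    unfolding ideal_gen_def using mult \<open>g \<in> R\<close>
    by (intro CollectI exI[of _ A] exI[of _ "\<lambda>q. g * h q"]) (simp add: sum_distrib_left mult.assoc)
qed

lemma ideal_gen_add: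
  assumes add: "\<And>p q. p \<in> R \<Longrightarrow> q \<in> R \<Longrightarrow> p + q \<in> R" and "0 \<in> R"
    and "f \<in> ideal_gen R G" "g \<in> ideal_gen R G"
  shows "f + g \<in> ideal_gen R G"
proof -
  from assms obtain A h where A: "finite A" "A \<subseteq> G" "\<forall>q\<in>A. h q \<in> R" "f = (\<Sum>q\<in>A. h q * q)"
    by (auto simp: ideal_gen_def)
  from assms obtain B k where B: "finite B" "B \<subseteq> G" "\<forall>q\<in>B. k q \<in> R" "g = (\<Sum>q\<in>B. k q * q)"
    by (auto simp: ideal_gen_def)
  \<comment> \<open>Extension by 0 puts both coefficient families on the common index set
    \<open>A \<union> B\<close>.\<close>
  let ?h = "\<lambda>q. if q \<in> A then h q else 0" and ?k = "\<lambda>q. if q \<in> B then k q else 0"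
  have "f = (\<Sum>q\<in>A \<union> B. ?h q * q)"
    unfolding A by (rule sum.mono_neutral_cong_left) (use A B in auto)
  moreover have "g = (\<Sum>q\<in>A \<union> B. ?k q * q)"
    unfolding B by (rule sum.mono_neutral_cong_left) (use A B in auto)
  ultimately have "f + g = (\<Sum>q\<in>A \<union> B. (?h q + ?k q) * q)"
    by (simp only: distrib_right sum.distrib)
  then show ?thesis
    unfolding ideal_gen_def using A B add \<open>0 \<in> R\<close>
    by (intro CollectI exI[of _ "A \<union> B"] exI[of _ "\<lambda>q. ?h q + ?k q"]) auto
qed

lemma QSym_plus_mult: "g \<in> polys_upto n \<Longrightarrow> f \<in> QSym_plus n \<Longrightarrow> g * f \<in> QSym_plus n"
  unfolding QSym_plus_def by (rule ideal_gen_mult) (auto intro: polys_upto_mult)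

lemma QSym_plus_add: "f \<in> QSym_plus n \<Longrightarrow> g \<in> QSym_plus n \<Longrightarrow> f + g \<in> QSym_plus n"
  unfolding QSym_plus_def by (rule ideal_gen_add) (auto intro: polys_upto_add polys_upto_0)

lemma QSym_plus_diff: "f \<in> QSym_plus n \<Longrightarrow> g \<in> QSym_plus n \<Longrightarrow> f - g \<in> QSym_plus n"
  using QSym_plus_add[of f n "(- 1) * g"] QSym_plus_mult[of "- 1" n g]
  by (simp add: polys_upto_1 polys_upto_uminus)

lemma QSym_plus_0: "0 \<in> QSym_plus n"
  unfolding QSym_plus_def ideal_gen_def by (intro CollectI exI[of _ "{}"]) simp

lemma QSym_plus_sum: "(\<And>x. x \<in> A \<Longrightarrow> f x \<in> QSym_plus n) \<Longrightarrow> sum f A \<in> QSym_plus n"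
  by (induction A rule: infinite_finite_induct) (auto simp: QSym_plus_0 QSym_plus_add)

lemma QSym_plus_generator:
  assumes "quasisymmetric n q" "homogeneous d q" "d > 0"
  shows "q \<in> QSym_plus n"
  unfolding QSym_plus_def ideal_gen_def using assms polys_upto_1
  by (intro CollectI exI[of _ "{q}"] exI[of _ "\<lambda>_. 1"]) auto

text \<open>The zero exponent splits only as \<open>0 + 0\<close>, and a generator, being
  homogeneous of positive degree, has no constant term.\<close>

lemma QSym_plus_constant_term:
  assumes "f \<in> QSym_plus n"
  shows "lookup f 0 = 0"
proof -
  from assms obtain A h where A: "\<forall>q\<in>A. quasisymmetric n q \<and> (\<exists>d>0. homogeneous d q)"
    "f = (\<Sum>q\<in>A. h q * q)"
    by (auto simp: QSym_plus_def ideal_gen_def)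
  have "lookup (h q * q) 0 = 0" if "q \<in> A" for q
  proof (rule ccontr)
    assume "lookup (h q * q) 0 \<noteq> 0"
    then have "0 \<in> keys (h q * q)" by (simp add: in_keys_iff)
    then obtain a b where "b \<in> keys q" "0 = a + b"
      using keys_mult[of "h q" q] by auto
    moreover have "b = 0"
      using keys_plus_expvec[of a b] \<open>0 = a + b\<close> by (simp flip: \<open>0 = a + b\<close>)
    ultimately show False
      using A that by (fastforce simp: homogeneous_iff total_degree_def)
  qed
  then show ?thesis by (simp add: A lookup_sum)
qed

lemma span_monomials_iff: "p \<in> qpoly.span (monomial ` A) \<longleftrightarrow> keys p \<subseteq> A"
proof
  assume "p \<in> qpoly.span (monomial ` A)"
  then show "keys p \<subseteq> A"
  proof (induction rule: qpoly.span_induct_alt)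
    case (step c x y)
    have "keys (smult c x) \<subseteq> keys x"
      using keys_mult[of "single 0 c" x] by (auto simp: smult_def split: if_splits)
    moreover have "keys x \<subseteq> A"
      using step by (auto simp: monomial_def)
    ultimately show ?case
      using keys_add[of "smult c x" y] step by blast
  qed simp
next
  assume "keys p \<subseteq> A"
  have "single d (lookup p d) = smult (lookup p d) (monomial d)" for d
    by (simp add: smult_def monomial_def mult_single)
  then have "p = (\<Sum>d\<in>keys p. smult (lookup p d) (monomial d))"
    using qpoly_expansion[of p] by simp
  also have "\<dots> \<in> qpoly.span (monomial ` A)"
    using \<open>keys p \<subseteq> A\<close> by (intro qpoly.span_sum qpoly.span_scale qpoly.span_base) auto
  finally show "p \<in> qpoly.span (monomial ` A)" .
qed


subsection \<open>Trimming operators\<close>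

definition gap :: "nat \<Rightarrow> nat \<Rightarrow> nat" where
  "gap i j = (if j < i then j else Suc j)"

lemma strict_mono_gap: "strict_mono (gap i)"
  by (auto simp: strict_mono_def gap_def)

lemma inj_gap [simp]: "inj (gap i)"
  by (simp add: strict_mono_gap strict_mono_imp_inj_on)

lemma range_gap: "range (gap i) = - {i}"
proof -
  have "j \<in> range (gap i)" if "j \<noteq> i" for j
    using that by (intro range_eqI[of _ _ "if j < i then j else j - 1"]) (auto simp: gap_def)
  then show ?thesis by (auto simp: gap_def)
qed

text \<open>\<open>gap (Suc i)\<close> and \<open>gap i\<close> differ only at \<open>i\<close>.
  This is what makes the difference of the two pullbacks divisible by \<open>X i\<close>.\<close>

lemma reindex_gap_Suc:
  assumes "lookup e i = 0"
  shows "reindex (gap (Suc i)) e = reindex (gap i) e"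
proof (rule reindex_eqI)
  show "lookup (reindex (gap i) e) (gap (Suc i) j) = lookup e j" for j
  proof (cases "j = i")
    case True
    have "i \<notin> range (gap i)" by (simp add: range_gap)
    with True show ?thesis
      using assms lookup_reindex_notin_range[of i "gap i" e] by (simp add: gap_def)
  next
    case False
    then have "gap (Suc i) j = gap i j" by (auto simp: gap_def)
    then show ?thesis by (simp add: lookup_reindex)
  qed
  show "lookup (reindex (gap i) e) j = 0" if "j \<notin> range (gap (Suc i))" for j
    using that assms lookup_reindex[of "gap i" e i] by (simp add: range_gap) (simp add: gap_def)
qed simp

lemma inj_plus_expvec: "inj (\<lambda>e :: expvec. e + d)"
  by (simp add: inj_def)

text \<open>\<open>pull (gap i)\<close> is \<open>R\<^sub>i\<close>, so this is \<open>T\<^sub>i\<close>; taking the coefficient at \<open>e + \<epsilon>\<^sub>i\<close> performs the division by \<open>x\<^sub>i\<close>.\<close>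

definition trim :: "nat \<Rightarrow> qpoly \<Rightarrow> qpoly" where
  "trim i p = Poly_Mapping.map_key (\<lambda>e. e + single i 1) (pull (gap (Suc i)) p - pull (gap i) p)"

lemma lookup_trim:
  "lookup (trim i p) e = lookup p (reindex (gap (Suc i)) (e + single i 1))
     - lookup p (reindex (gap i) (e + single i 1))"
  by (simp add: trim_def map_key.rep_eq inj_plus_expvec lookup_minus lookup_pull)

lemma lookup_X_mult:
  "lookup (X i * p) e = (if lookup e i = 0 then 0 else lookup p (e - single i 1))"
proof -
  have "X i * p = X i * (\<Sum>d\<in>keys p. single d (lookup p d))"
    by (simp only: qpoly_expansion)
  then have "lookup (X i * p) e = (\<Sum>d\<in>keys p. lookup p d when single i 1 + d = e)"
    by (simp add: X_def monomial_def sum_distrib_left mult_single lookup_sum lookup_single)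
  also have "\<dots> = (if lookup e i = 0 then 0 else lookup p (e - single i 1))"
  proof (cases "lookup e i = 0")
    case True
    then have "single i 1 + d \<noteq> e" for d
      by (auto simp: lookup_add)
    with True show ?thesis by (simp add: when_def)
  next
    case False
    then have e: "single i 1 + (e - single i 1) = e"
      by (intro poly_mapping_eqI) (auto simp: lookup_add lookup_minus lookup_single when_def)
    then have "single i 1 + d = e \<longleftrightarrow> d = e - single i 1" for d
      by (metis add_diff_cancel_left')
    then have "(\<Sum>d\<in>keys p. lookup p d when single i 1 + d = e) =
        (\<Sum>d\<in>keys p. if d = e - single i 1 then lookup p d else 0)"
      by (simp add: when_def)
    with False show ?thesis
      by (simp add: sum.delta in_keys_iff)
  qed
  finally show ?thesis .
qed

lemma X_mult_trim: "X i * trim i p = pull (gap (Suc i)) p - pull (gap i) p"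
proof (rule poly_mapping_eqI)
  fix e
  show "lookup (X i * trim i p) e = lookup (pull (gap (Suc i)) p - pull (gap i) p) e"
  proof (cases "lookup e i = 0")
    case True
    then show ?thesis by (simp add: lookup_X_mult lookup_minus lookup_pull reindex_gap_Suc)
  next
    case False
    then have "e - single i 1 + single i 1 = e"
      by (intro poly_mapping_eqI) (auto simp: lookup_add lookup_minus lookup_single when_def)
    with False show ?thesis by (simp add: lookup_X_mult lookup_minus lookup_pull lookup_trim)
  qed
qed

lemma X_mult_cancel: "X i * p = X i * q \<Longrightarrow> p = q"
proof (rule poly_mapping_eqI)
  fix e assume eq: "X i * p = X i * q"
  have "lookup (X i * p) (e + single i 1) = lookup (X i * q) (e + single i 1)" by (simp only: eq)
  then show "lookup p e = lookup q e" by (simp add: lookup_X_mult lookup_add)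
qed

text \<open>A twisted Leibniz rule: both pullbacks are ring homomorphisms, so a factor on which they
  agree comes out of the difference, and \<open>X i\<close> can be cancelled.\<close>

lemma trim_mult:
  assumes "pull (gap (Suc i)) q = pull (gap i) q"
  shows "trim i (h * q) = trim i h * pull (gap i) q"
proof (rule X_mult_cancel[of i])
  have "X i * trim i (h * q) = (pull (gap (Suc i)) h - pull (gap i) h) * pull (gap i) q"
    by (simp add: X_mult_trim pull_mult assms left_diff_distrib)
  also have "\<dots> = X i * (trim i h * pull (gap i) q)"
    by (simp add: mult.assoc flip: X_mult_trim)
  finally show "X i * trim i (h * q) = X i * (trim i h * pull (gap i) q)" .
qed

lemma trim_sum: "trim i (sum f A) = (\<Sum>x\<in>A. trim i (f x))"
  by (rule poly_mapping_eqI) (simp add: lookup_trim lookup_sum sum_subtractf)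

section \<open>Quasisymmetric polynomials under deletion of a variable\<close>

lemma reindex_sorted:
  "reindex \<sigma> e = (\<Sum>r<card (keys e). single (\<sigma> (sorted_list_of_set (keys e) ! r))
     (lookup e (sorted_list_of_set (keys e) ! r)))"
proof -
  let ?l = "sorted_list_of_set (keys e)"
  have "bij_betw (\<lambda>r. ?l ! r) {..<card (keys e)} (keys e)"
    by (rule bij_betw_nth) auto
  then show ?thesis
    unfolding reindex_def by (rule sum.reindex_bij_betw[symmetric])
qed

lemma quasisymmetricD:
  fixes k :: nat and i j a :: "nat \<Rightarrow> nat"
  assumes "quasisymmetric n p" "\<And>r. r < k \<Longrightarrow> a r > 0"
    and "strict_mono_on {..<k} i" "i ` {..<k} \<subseteq> {1..n}"
    and "strict_mono_on {..<k} j" "j ` {..<k} \<subseteq> {1..n}"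
  shows "lookup p (\<Sum>r<k. single (i r) (a r)) = lookup p (\<Sum>r<k. single (j r) (a r))"
  using assms(1)[unfolded quasisymmetric_def, THEN conjunct2, rule_format, of k a i j] assms(2-6)
  by blast

text \<open>Read along the increasing support of \<open>e\<close>, both exponents show the same
  sequence of positive entries at increasing positions.\<close>

lemma quasisymmetric_reindex:
  assumes "quasisymmetric n q" "strict_mono \<sigma>" "strict_mono \<tau>"
    and "\<sigma> ` keys e \<subseteq> {1..n}" "\<tau> ` keys e \<subseteq> {1..n}"
  shows "lookup q (reindex \<sigma> e) = lookup q (reindex \<tau> e)"
proof -
  let ?l = "sorted_list_of_set (keys e)" and ?k = "card (keys e)"
  have l: "?l ! r \<in> keys e" if "r < ?k" for r
    using that nth_mem[of r ?l] by simp
  have mono: "strict_mono_on {..<?k} (\<lambda>r. \<rho> (?l ! r))" if "strict_mono \<rho>" for \<rho> :: "nat \<Rightarrow> nat"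
    using that strict_sorted_list_of_set[of "keys e"]
    by (auto simp: strict_mono_on_def strict_mono_def sorted_wrt_iff_nth_less)
  have pos: "lookup e (?l ! r) > 0" if "r < ?k" for r
    using l[OF that] by (simp add: in_keys_iff)
  have "(\<lambda>r. \<sigma> (?l ! r)) ` {..<?k} \<subseteq> {1..n}" "(\<lambda>r. \<tau> (?l ! r)) ` {..<?k} \<subseteq> {1..n}"
    using assms(4,5) l by blast+
  then show ?thesis
    unfolding reindex_sorted[of _ e]
    by (intro quasisymmetricD[OF assms(1)] pos mono assms(2,3))
qed

lemma gap_image_subset:
  assumes "1 \<le> i" "i \<le> n"
  shows "gap i ` A \<subseteq> {1..n} \<longleftrightarrow> A \<subseteq> {1..n-1}"
proof -
  have "gap i j \<in> {1..n} \<longleftrightarrow> j \<in> {1..n-1}" for j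
    using assms by (auto simp: gap_def)
  then show ?thesis by blast
qed

text \<open>Both gaps are strictly increasing, so quasisymmetry applies to exponents supported in
  \<open>{1..n-1}\<close>. Any other exponent is moved out of \<open>{1..n}\<close> by either gap,
  and both coefficients vanish.\<close>

lemma pull_gap_quasisymmetric:
  assumes "quasisymmetric n q" "1 \<le> i" "i < n"
  shows "pull (gap (Suc i)) q = pull (gap i) q"
proof (rule poly_mapping_eqI)
  fix e
  have out: "lookup q (reindex (gap j) e) = 0" if "\<not> keys e \<subseteq> {1..n-1}" "1 \<le> j" "j \<le> n" for j
  proof -
    have "\<not> keys (reindex (gap j) e) \<subseteq> {1..n}"
      using that by (simp add: keys_reindex gap_image_subset del: One_nat_def)
    then show ?thesis
      using assms(1) unfolding quasisymmetric_def polys_upto_def by (auto simp: in_keys_iff)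
  qed
  show "lookup (pull (gap (Suc i)) q) e = lookup (pull (gap i) q) e"
  proof (cases "keys e \<subseteq> {1..n-1}")
    case True
    then have "gap (Suc i) ` keys e \<subseteq> {1..n}" "gap i ` keys e \<subseteq> {1..n}"
      using assms by (simp_all add: gap_image_subset del: One_nat_def)
    then show ?thesis
      by (simp add: lookup_pull quasisymmetric_reindex[OF assms(1)] strict_mono_gap)
  next
    case False
    then show ?thesis
      using assms by (simp add: lookup_pull out del: One_nat_def)
  qed
qed

lemma quasisymmetric_pull_gap:
  assumes "quasisymmetric n q" "1 \<le> i" "i \<le> n"
  shows "quasisymmetric (n - 1) (pull (gap i) q)"
  unfolding quasisymmetric_def
proof (intro conjI allI impI)
  have "keys e \<subseteq> {1..n-1}" if "e \<in> keys (pull (gap i) q)" for e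
  proof -
    have "gap i ` keys e \<subseteq> {1..n}"
      using that assms(1) unfolding quasisymmetric_def polys_upto_def
      by (simp add: keys_pull flip: keys_reindex)
    then show ?thesis
      using assms by (subst (asm) gap_image_subset) auto
  qed
  then show "pull (gap i) q \<in> polys_upto (n - 1)"
    by (simp add: polys_upto_def)
next
  fix k :: nat and a s t :: "nat \<Rightarrow> nat"
  assume a: "\<forall>r<k. a r > (0::nat)"
    and s: "strict_mono_on {..<k} s" "s ` {..<k} \<subseteq> {1..n-1}"
    and t: "strict_mono_on {..<k} t" "t ` {..<k} \<subseteq> {1..n-1}"
  have mono: "strict_mono_on {..<k} (\<lambda>r. gap i (u r))" if "strict_mono_on {..<k} u" for u :: "nat \<Rightarrow> nat"
    using that strict_mono_gap[of i] by (auto simp: strict_mono_on_def strict_mono_def)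
  have "(\<lambda>r. gap i (s r)) ` {..<k} \<subseteq> {1..n}" "(\<lambda>r. gap i (t r)) ` {..<k} \<subseteq> {1..n}"
    using s(2) t(2) assms gap_image_subset[of i n "s ` {..<k}"] gap_image_subset[of i n "t ` {..<k}"]
    by (simp_all add: image_image del: One_nat_def)
  then have "lookup q (\<Sum>r<k. single (gap i (s r)) (a r)) = lookup q (\<Sum>r<k. single (gap i (t r)) (a r))"
    using a by (intro quasisymmetricD[OF assms(1)] mono s(1) t(1)) auto
  then show "lookup (pull (gap i) q) (\<Sum>r<k. single (s r) (a r)) =
      lookup (pull (gap i) q) (\<Sum>r<k. single (t r) (a r))"
    by (simp add: lookup_pull reindex_sum)
qed

lemma homogeneous_pull: "inj \<sigma> \<Longrightarrow> homogeneous d q \<Longrightarrow> homogeneous d (pull \<sigma> q)"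
  by (auto simp: homogeneous_iff keys_pull) (metis total_degree_reindex)

lemma keys_trimD:
  assumes "e \<in> keys (trim i p)"
  shows "reindex (gap (Suc i)) (e + single i 1) \<in> keys p \<or> reindex (gap i) (e + single i 1) \<in> keys p"
  using assms by (auto simp: in_keys_iff lookup_trim)

lemma polys_upto_trim:
  assumes "p \<in> polys_upto n" "1 \<le> i" "i < n"
  shows "trim i p \<in> polys_upto (n - 1)"
proof -
  have "keys e \<subseteq> {1..n-1}" if e: "e \<in> keys (trim i p)" for e
  proof -
    obtain j where j: "j = i \<or> j = Suc i" "reindex (gap j) (e + single i 1) \<in> keys p"
      using keys_trimD[OF e] by auto
    then have "gap j ` keys (e + single i 1) \<subseteq> {1..n}"
      using assms(1) unfolding polys_upto_def by (metis (mono_tags) inj_gap keys_reindex mem_Collect_eq)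
    then have "keys (e + single i 1) \<subseteq> {1..n-1}"
      using j(1) assms by (subst (asm) gap_image_subset) auto
    then show ?thesis by (simp add: keys_plus_expvec)
  qed
  then show ?thesis by (simp add: polys_upto_def)
qed

text \<open>The two pullbacks agree on a generator \<open>q\<close>, so
  \<open>trim i (h * q)\<close> is a multiple of \<open>pull (gap i) q\<close>, which is
  quasisymmetric of the same degree in one variable less.\<close>

lemma QSym_plus_trim:
  assumes "f \<in> QSym_plus n" "1 \<le> i" "i < n"
  shows "trim i f \<in> QSym_plus (n - 1)"
proof -
  from assms obtain A h where A: "\<forall>q\<in>A. quasisymmetric n q \<and> (\<exists>d>0. homogeneous d q)"
    "f = (\<Sum>q\<in>A. h q * q)" "\<forall>q\<in>A. h q \<in> polys_upto n"
    by (auto simp: QSym_plus_def ideal_gen_def)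
  have "trim i (h q * q) \<in> QSym_plus (n - 1)" if "q \<in> A" for q
  proof -
    from bspec[OF A(1) \<open>q \<in> A\<close>] obtain d where q: "quasisymmetric n q" "d > 0" "homogeneous d q"
      by auto
    have "pull (gap i) q \<in> QSym_plus (n - 1)"
      using quasisymmetric_pull_gap[OF q(1) \<open>1 \<le> i\<close>] homogeneous_pull[OF inj_gap q(3)] q(2) \<open>i < n\<close>
      by (intro QSym_plus_generator[of _ _ d]) auto
    moreover have "trim i (h q) \<in> polys_upto (n - 1)"
      using A(3) that assms polys_upto_trim by blast
    ultimately show ?thesis
      using trim_mult[OF pull_gap_quasisymmetric[OF q(1) assms(2,3)]] by (simp add: QSym_plus_mult)
  qed
  then show ?thesis by (simp add: A(2) trim_sum QSym_plus_sum)
qed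


subsection \<open>Uniqueness of the reduction\<close>

text \<open>The defining inequality for \<open>j\<close> concerns the tail that starts at
  \<open>m = n + 1 - j\<close>.\<close>

lemma ABB_iff:
  "c \<in> ABB n \<longleftrightarrow> keys c \<subseteq> {1..n} \<and> (\<forall>m\<in>{1..n}. (\<Sum>j=m..n. lookup c j) \<le> n - m)"
proof -
  have tail: "(\<Sum>i=1..j. lookup c (n + 1 - i)) = (\<Sum>i=n+1-j..n. lookup c i)" if "j \<le> n" for j
    using that
    by (intro sum.reindex_bij_witness[of _ "\<lambda>i. n + 1 - i" "\<lambda>i. n + 1 - i"]) auto
  have "(\<forall>j\<in>{1..n}. (\<Sum>i=1..j. lookup c (n + 1 - i)) \<le> j - 1) \<longleftrightarrow>
      (\<forall>m\<in>{1..n}. (\<Sum>j=m..n. lookup c j) \<le> n - m)" (is "?L \<longleftrightarrow> ?R")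
  proof
    assume L: ?L
    show ?R
    proof
      fix m assume "m \<in> {1..n}"
      then have "n + 1 - m \<in> {1..n}" "n + 1 - m \<le> n" "n + 1 - (n + 1 - m) = m" "n + 1 - m - 1 = n - m"
        by auto
      with bspec[OF L, of "n + 1 - m"] tail[of "n + 1 - m"]
      show "(\<Sum>j=m..n. lookup c j) \<le> n - m" by simp
    qed
  next
    assume R: ?R
    show ?L
    proof
      fix j assume "j \<in> {1..n}"
      then have "n + 1 - j \<in> {1..n}" "j \<le> n" "n - (n + 1 - j) = j - 1"
        by auto
      with bspec[OF R, of "n + 1 - j"] tail[of j]
      show "(\<Sum>i=1..j. lookup c (n + 1 - i)) \<le> j - 1" by simp
    qed
  qed
  then show ?thesis by (simp add: ABB_def)
qed

text \<open>For \<open>m \<le> i\<close> the tail of the larger exponent contains the unit added at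
  \<open>i\<close>, which lowers the bound for \<open>e\<close> by one. For \<open>m > i\<close> the
  gap carries the tail of \<open>e\<close> from \<open>m\<close> to a tail starting at
  \<open>m + 1\<close>, where the bound is smaller by one anyway.\<close>

lemma ABB_trim:
  assumes d: "reindex (gap t) (e + single i 1) \<in> ABB n" and t: "t = i \<or> t = Suc i" and i: "1 \<le> i" "i < n"
  shows "e \<in> ABB (n - 1)"
  unfolding ABB_iff
proof (intro conjI ballI)
  let ?d = "reindex (gap t) (e + single i 1)"
  have "gap t ` keys (e + single i 1) \<subseteq> {1..n}"
    using d by (simp add: ABB_iff keys_reindex)
  then have "keys (e + single i 1) \<subseteq> {1..n-1}"
    using t i by (subst (asm) gap_image_subset) auto
  then show "keys e \<subseteq> {1..n-1}"
    by (simp add: keys_plus_expvec)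
  have tail: "(\<Sum>j=m..n. lookup ?d j) \<le> n - m" if "m \<in> {1..n}" for m
    using d that by (simp add: ABB_iff)
  have look: "lookup ?d (gap t j) = lookup e j + (if j = i then 1 else 0)" for j
    by (simp add: lookup_reindex lookup_add lookup_single when_def)
  fix m assume m: "m \<in> {1..n-1}"
  show "(\<Sum>j=m..n-1. lookup e j) \<le> n - 1 - m"
  proof (cases "m \<le> i")
    case True
    have "Suc (\<Sum>j=m..n-1. lookup e j) = (\<Sum>j=m..n-1. lookup ?d (gap t j))"
      using True i unfolding look by (simp add: sum.distrib sum.delta)
    also have "\<dots> = (\<Sum>j\<in>gap t ` {m..n-1}. lookup ?d j)"
      by (simp add: sum.reindex inj_on_subset[OF inj_gap])
    also have "\<dots> \<le> (\<Sum>j=m..n. lookup ?d j)"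
      using i by (intro sum_mono2) (auto simp: gap_def)
    also have "\<dots> \<le> n - m"
      using m by (intro tail) auto
    finally show ?thesis by simp
  next
    case False
    have "(\<Sum>j=m..n-1. lookup e j) = (\<Sum>j=m..n-1. lookup ?d (gap t j))"
      using False unfolding look by (intro sum.cong) auto
    also have "\<dots> = (\<Sum>j\<in>gap t ` {m..n-1}. lookup ?d j)"
      by (simp add: sum.reindex inj_on_subset[OF inj_gap])
    also have "\<dots> \<le> (\<Sum>j=Suc m..n. lookup ?d j)"
      using i t False by (intro sum_mono2) (auto simp: gap_def)
    also have "\<dots> \<le> n - Suc m"
      using m by (intro tail) auto
    finally show ?thesis by simp
  qed
qed

lemma QSym_plus_Int_ABB:
  assumes "keys r \<subseteq> ABB n" "r \<in> QSym_plus n"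
  shows "r = 0"
  using assms
proof (induction n arbitrary: r rule: less_induct)
  case (less n)
  \<comment> \<open>By induction every \<open>trim i r\<close> vanishes, so moving the gap by one
    position does not change the coefficients of \<open>r\<close>.\<close>
  have shift: "lookup r (reindex (gap (Suc i)) d) = lookup r (reindex (gap i) d)"
    if i: "1 \<le> i" "i < n" for i d
  proof -
    have "keys (trim i r) \<subseteq> ABB (n - 1)"
    proof
      fix e assume "e \<in> keys (trim i r)"
      from keys_trimD[OF this] show "e \<in> ABB (n - 1)"
        using less.prems(1) ABB_trim[OF _ _ i] by blast
    qed
    moreover have "trim i r \<in> QSym_plus (n - 1)"
      using less.prems(2) i by (rule QSym_plus_trim)
    ultimately have "trim i r = 0"
      using i by (intro less.IH) auto
    then have "pull (gap (Suc i)) r = pull (gap i) r"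
      using X_mult_trim[of i r] by simp
    then show ?thesis
      by (metis inj_gap lookup_pull)
  qed
  have "keys r \<subseteq> {0}"
  proof (rule ccontr)
    assume "\<not> keys r \<subseteq> {0}"
    then have ne: "keys r - {0} \<noteq> {}" by auto
    \<comment> \<open>The largest index of a variable occurring in \<open>r\<close>. The shift will
      produce a monomial of \<open>r\<close> that contains \<open>X (Suc k)\<close>.\<close>
    define k where "k = Max ((\<lambda>d. Max (keys d)) ` (keys r - {0}))"
    have "k \<in> (\<lambda>d. Max (keys d)) ` (keys r - {0})"
      unfolding k_def using ne by (intro Max_in) auto
    then obtain d where d: "d \<in> keys r" "d \<noteq> 0" "k = Max (keys d)" by auto
    have kd: "k \<in> keys d" and le: "\<And>j. j \<in> keys d \<Longrightarrow> j \<le> k"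
      using d by auto
    have dA: "d \<in> ABB n" using d(1) less.prems(1) by blast
    then have kn: "k \<in> {1..n}" using kd unfolding ABB_iff by blast
    \<comment> \<open>The tail inequality at \<open>m = n\<close> makes the last exponent 0; hence
      \<open>k < n\<close> and the shift is allowed at \<open>k\<close>.\<close>
    then have "(\<Sum>j=n..n. lookup d j) \<le> n - n"
      using dA unfolding ABB_iff by (elim conjE ballE[of _ _ n]) auto
    with kn have k: "1 \<le> k" "k < n"
      using kd by (auto simp: in_keys_iff intro: le_neq_implies_less)
    have "lookup d j = 0" if "k < j" for j
      using le[of j] that by (meson in_keys_iff not_le)
    then have "reindex (gap (Suc k)) d = d"
      by (intro reindex_eqI) (simp_all add: gap_def range_gap)
    then have "reindex (gap k) d \<in> keys r"
      using shift[OF k, of d] d by (simp add: in_keys_iff)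
    moreover have "Suc k \<in> keys (reindex (gap k) d)"
      using kd by (auto simp: keys_reindex gap_def image_iff intro!: bexI[of _ k])
    ultimately have "Suc k \<le> Max (keys (reindex (gap k) d))" "reindex (gap k) d \<in> keys r - {0}"
      by auto
    then have "Suc k \<le> k"
      unfolding k_def by (smt (verit) Max_ge finite_Diff finite_imageI finite_keys imageI order_trans)
    then show False by simp
  qed
  moreover have "0 \<notin> keys r"
    using QSym_plus_constant_term[OF less.prems(2)] by (simp add: in_keys_iff)
  ultimately have "keys r = {}" by blast
  then show "r = 0" by simp
qed

lemma reduction_eqI:
  assumes "keys r \<subseteq> ABB n" "p - r \<in> QSym_plus n"
  shows "reduction n p = r"
  unfolding reduction_def is_reduction_def span_monomials_iff
proof (rule the_equality)
  fix s assume s: "keys s \<subseteq> ABB n \<and> p - s \<in> QSym_plus n"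
  have "(p - r) - (p - s) \<in> QSym_plus n"
    using assms s QSym_plus_diff by blast
  then have "s - r = 0"
    using keys_diff[of s r] assms s by (intro QSym_plus_Int_ABB[of _ n]) auto
  then show "s = r" by simp
qed (use assms in auto)


subsection \<open>Labelings of a plane binary tree with and without upper bounds\<close>

text \<open>
  \<open>free_sum n t m\<close> is the generating function of the labelings of \<open>t\<close> with values in \<open>{m..n}\<close> that
  increase weakly along left edges and strictly along right edges. In \<open>bounded_sum n t s m\<close> the
  nodes carry in addition the canonical labels \<open>s, s + 1, \<dots>\<close> in inorder, and the value at a node is
  at most the canonical label of its leftmost descendant.
\<close>

fun free_sum :: "nat \<Rightarrow> nat tree \<Rightarrow> nat \<Rightarrow> qpoly" where
  "free_sum n Leaf m = 1"
| "free_sum n (Node l v r) m = (\<Sum>k=m..n. X k * free_sum n l k * free_sum n r (Suc k))"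

fun bounded_sum :: "nat \<Rightarrow> nat tree \<Rightarrow> nat \<Rightarrow> nat \<Rightarrow> qpoly" where
  "bounded_sum n Leaf s m = 1"
| "bounded_sum n (Node l v r) s m =
     (\<Sum>k=m..min s n. X k * bounded_sum n l s k * bounded_sum n r (s + size l + 1) (Suc k))"

text \<open>Makes the upper bound of an ancestor redundant: its summands with too large a value
  contain a factor of this form.\<close>

lemma bounded_sum_eq_0: "t \<noteq> Leaf \<Longrightarrow> s < m \<Longrightarrow> bounded_sum n t s m = 0"
  by (cases t) auto

lemma polys_upto_free_sum: "1 \<le> m \<Longrightarrow> free_sum n t m \<in> polys_upto n"
proof (induction t arbitrary: m)
  case (Node l v r)
  have "X k * free_sum n l k * free_sum n r (Suc k) \<in> polys_upto n" if "k \<in> {m..n}" for k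
    using that Node by (intro polys_upto_mult polys_upto_X) auto
  then show ?case unfolding free_sum.simps by (rule polys_upto_sum)
qed (simp add: polys_upto_1)

lemma homogeneous_free_sum: "homogeneous (size t) (free_sum n t m)"
proof (induction t arbitrary: m)
  case (Node l v r)
  have "homogeneous (1 + size l + size r) (X k * free_sum n l k * free_sum n r (Suc k))" for k
    by (intro homogeneous_mult homogeneous_X Node)
  then show ?case by (simp add: homogeneous_sum)
qed (simp add: homogeneous_1)

text \<open>
  What remains of \<open>free_sum\<close> after keeping only the \<open>k\<close> variables indexed by a strictly increasing
  sequence and renaming them to \<open>x\<^sub>0, \<dots>, x\<^bsub>k-1\<^esub>\<close>. It does not depend on the sequence.
\<close>

fun packed_sum :: "nat \<Rightarrow> nat tree \<Rightarrow> nat \<Rightarrow> qpoly" where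
  "packed_sum k Leaf a = 1"
| "packed_sum k (Node l v r) a = (\<Sum>i=a..<k. X i * packed_sum k l i * packed_sum k r (Suc i))"

lemma pull_free_sum:
  assumes \<sigma>: "strict_mono \<sigma>" and k: "\<And>i. \<sigma> i \<le> n \<longleftrightarrow> i < k" and "\<And>i. m \<le> \<sigma> i \<longleftrightarrow> a \<le> i"
  shows "pull \<sigma> (free_sum n t m) = packed_sum k t a"
  using assms(3)
proof (induction t arbitrary: m a)
  case Leaf
  then show ?case using \<sigma> by (simp add: pull_1 strict_mono_imp_inj_on)
next
  case (Node l v r)
  have inj: "inj \<sigma>" using \<sigma> by (rule strict_mono_imp_inj_on)
  have "pull \<sigma> (free_sum n (Node l v r) m) =
      (\<Sum>j=m..n. pull \<sigma> (X j) * pull \<sigma> (free_sum n l j) * pull \<sigma> (free_sum n r (Suc j)))"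
    by (simp add: pull_sum pull_mult inj)
  \<comment> \<open>Values outside the range of \<open>\<sigma>\<close> contribute 0 through
    \<open>pull \<sigma> (X j)\<close>. The others are \<open>\<sigma> i\<close> with
    \<open>a \<le> i < k\<close>, and comparing them amounts to comparing indices.\<close>
  also have "\<dots> = (\<Sum>j\<in>\<sigma> ` {a..<k}. pull \<sigma> (X j) * pull \<sigma> (free_sum n l j) * pull \<sigma> (free_sum n r (Suc j)))"
  proof (rule sum.mono_neutral_right)
    show "\<sigma> ` {a..<k} \<subseteq> {m..n}"
      using k Node.prems by auto
    show "\<forall>j\<in>{m..n} - \<sigma> ` {a..<k}.
        pull \<sigma> (X j) * pull \<sigma> (free_sum n l j) * pull \<sigma> (free_sum n r (Suc j)) = 0"
    proof
      fix j assume j: "j \<in> {m..n} - \<sigma> ` {a..<k}"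
      have "j \<notin> range \<sigma>"
        using j k Node.prems by auto
      then show "pull \<sigma> (X j) * pull \<sigma> (free_sum n l j) * pull \<sigma> (free_sum n r (Suc j)) = 0"
        by (simp add: pull_X_notin inj)
    qed
  qed simp
  also have "\<dots> = (\<Sum>i=a..<k. X i * packed_sum k l i * packed_sum k r (Suc i))"
  proof (subst sum.reindex)
    have le: "\<sigma> i \<le> \<sigma> j \<longleftrightarrow> i \<le> j" "Suc (\<sigma> i) \<le> \<sigma> j \<longleftrightarrow> Suc i \<le> j" for i j
      using \<sigma> by (auto simp: strict_mono_less_eq strict_mono_less Suc_le_eq)
    show "sum ((\<lambda>j. pull \<sigma> (X j) * pull \<sigma> (free_sum n l j) * pull \<sigma> (free_sum n r (Suc j))) \<circ> \<sigma>) {a..<k} =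
        (\<Sum>i=a..<k. X i * packed_sum k l i * packed_sum k r (Suc i))"
      using Node.IH le by (simp add: pull_X inj)
  qed (use inj in \<open>auto intro: inj_on_subset\<close>)
  finally show ?case by simp
qed

lemma lookup_free_sum_strict_mono:
  fixes k :: nat and i a :: "nat \<Rightarrow> nat"
  assumes i: "strict_mono_on {..<k} i" "i ` {..<k} \<subseteq> {1..n}"
  shows "lookup (free_sum n t 1) (\<Sum>r<k. single (i r) (a r)) =
    lookup (packed_sum k t 0) (\<Sum>r<k. single r (a r))"
proof -
  \<comment> \<open>Values above \<open>n\<close> extend \<open>i\<close> to a strictly increasing
    map on all indices without keeping any further variable of the sum.\<close>
  define \<sigma> where "\<sigma> r = (if r < k then i r else n + 1 + r)" for r
  have ik: "1 \<le> i r" "i r \<le> n" if "r < k" for r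
    using i(2) that by auto
  have "strict_mono \<sigma>"
  proof (rule strict_monoI)
    fix r s :: nat assume "r < s"
    then show "\<sigma> r < \<sigma> s"
      using i(1) ik[of r] by (auto simp: \<sigma>_def strict_mono_on_def)
  qed
  moreover have "\<sigma> r \<le> n \<longleftrightarrow> r < k" "1 \<le> \<sigma> r \<longleftrightarrow> 0 \<le> r" for r
    using ik[of r] by (auto simp: \<sigma>_def)
  ultimately have "pull \<sigma> (free_sum n t 1) = packed_sum k t 0"
    by (intro pull_free_sum) auto
  moreover have inj: "inj \<sigma>"
    using \<open>strict_mono \<sigma>\<close> by (rule strict_mono_imp_inj_on)
  moreover have "reindex \<sigma> (\<Sum>r<k. single r (a r)) = (\<Sum>r<k. single (i r) (a r))"
    by (simp add: reindex_sum inj \<sigma>_def)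
  ultimately show ?thesis
    by (metis lookup_pull)
qed

lemma quasisymmetric_free_sum: "quasisymmetric n (free_sum n t 1)"
  unfolding quasisymmetric_def
  by (auto simp: polys_upto_free_sum lookup_free_sum_strict_mono[simplified])

lemma free_sum_in_QSym_plus: "t \<noteq> Leaf \<Longrightarrow> free_sum n t 1 \<in> QSym_plus n"
  by (rule QSym_plus_generator[OF quasisymmetric_free_sum homogeneous_free_sum]) (cases t; simp)


subsection \<open>Trees reaching beyond \<open>n\<close>\<close>

text \<open>
  A context is the path from a node up to the root, innermost first. \<open>Left_of r\<close> passes from a left
  child to its parent, whose right subtree \<open>r\<close> is still bounded; \<open>Right_of l\<close> passes from a
  right child to its parent, whose left subtree \<open>l\<close> is already free. The second argument of \<open>plug\<close>
  is the last canonical label in the hole.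
\<close>

datatype frame = Left_of "nat tree" | Right_of "nat tree"

fun plug :: "nat \<Rightarrow> nat \<Rightarrow> frame list \<Rightarrow> (nat \<Rightarrow> qpoly) \<Rightarrow> nat \<Rightarrow> qpoly" where
  "plug n e [] f = f"
| "plug n e (Left_of r # C) f =
     plug n (e + 1 + size r) C (\<lambda>m. \<Sum>k=m..n. X k * f k * bounded_sum n r (e + 2) (Suc k))"
| "plug n e (Right_of l # C) f =
     plug n e C (\<lambda>m. \<Sum>k=m..n. X k * free_sum n l k * f (Suc k))"

text \<open>The number of nodes outside the hole that follow it in inorder.\<close>

fun remaining :: "frame list \<Rightarrow> nat" where
  "remaining [] = 0"
| "remaining (Left_of r # C) = 1 + size r + remaining C"
| "remaining (Right_of l # C) = remaining C"

text \<open>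
  The node under consideration has canonical label \<open>i\<close> and upper bound \<open>B\<close>; the nodes before it in
  inorder are free, those after it are bounded by their canonical labels.
\<close>

definition partial_sum :: "nat \<Rightarrow> nat \<Rightarrow> nat \<Rightarrow> nat tree \<Rightarrow> nat tree \<Rightarrow> nat \<Rightarrow> qpoly" where
  "partial_sum n i B l r m = (\<Sum>k=m..min B n. X k * free_sum n l k * bounded_sum n r (Suc i) (Suc k))"

text \<open>\<open>i + size r\<close> is the last label in the hole and
  \<open>i + size r + remaining C\<close> the last label of the whole tree, so the second premise
  says that the tree reaches \<open>n\<close>.\<close>

definition partial_sum_in_ideal :: "nat \<Rightarrow> nat \<Rightarrow> nat \<Rightarrow> nat tree \<Rightarrow> nat tree \<Rightarrow> frame list \<Rightarrow> bool" where
  "partial_sum_in_ideal n i B l r C \<longleftrightarrow>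
     (i \<le> B \<longrightarrow> n \<le> i + size r + remaining C \<longrightarrow>
      plug n (i + size r) C (partial_sum n i B l r) 1 \<in> QSym_plus n)"

text \<open>A context only multiplies by fixed factors and sums, so it is linear over polynomials
  \<open>g\<close> that do not depend on the lower bound.\<close>

lemma plug_diff_mult: "plug n e C (\<lambda>m. f m - g * h m) m = plug n e C f m - g * plug n e C h m"
proof (induction n e C f arbitrary: h m rule: plug.induct)
  case (2 n e r C f)
  have eq: "(\<lambda>m. \<Sum>k=m..n. X k * (f k - g * h k) * bounded_sum n r (e + 2) (Suc k)) =
      (\<lambda>m. (\<Sum>k=m..n. X k * f k * bounded_sum n r (e + 2) (Suc k))
        - g * (\<Sum>k=m..n. X k * h k * bounded_sum n r (e + 2) (Suc k)))"
    by (simp add: fun_eq_iff sum_distrib_left algebra_simps flip: sum_subtractf)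
  show ?case by (simp only: plug.simps eq 2)
next
  case (3 n e l C f)
  have eq: "(\<lambda>m. \<Sum>k=m..n. X k * free_sum n l k * (f (Suc k) - g * h (Suc k))) =
      (\<lambda>m. (\<Sum>k=m..n. X k * free_sum n l k * f (Suc k))
        - g * (\<Sum>k=m..n. X k * free_sum n l k * h (Suc k)))"
    by (simp add: fun_eq_iff sum_distrib_left algebra_simps flip: sum_subtractf)
  show ?case by (simp only: plug.simps eq 3)
qed simp

text \<open>With the hole completely free, one climbs: a \<open>Right_of\<close> parent is free and
  joins the free tree, a \<open>Left_of\<close> parent is the next node in inorder and falls under
  the assumption, and at the root the sum is a generator of the ideal.\<close>

lemma plug_free_sum_in_ideal:
  assumes "t \<noteq> Leaf" "n \<le> i + remaining C"
    and "\<And>i B l r C'. size r + remaining C' < remaining C \<Longrightarrow> partial_sum_in_ideal n i B l r C'"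
  shows "plug n i C (free_sum n t) 1 \<in> QSym_plus n"
  using assms
proof (induction C arbitrary: t)
  case Nil
  then show ?case using free_sum_in_QSym_plus[of t n] by simp
next
  case (Cons fr C)
  show ?case
  proof (cases fr)
    case (Left_of r)
    \<comment> \<open>The bound \<open>max n (Suc i)\<close> does not restrict values in
      \<open>{1..n}\<close>, yet is at least the label \<open>Suc i\<close>.\<close>
    have "partial_sum_in_ideal n (Suc i) (max n (Suc i)) t r C"
      using Cons.prems(3) by (simp add: Left_of)
    moreover have "plug n i (fr # C) (free_sum n t) =
        plug n (Suc i + size r) C (partial_sum n (Suc i) (max n (Suc i)) t r)"
      by (simp add: Left_of partial_sum_def[abs_def] min_def)
    ultimately show ?thesis
      using Cons.prems(2) by (simp add: partial_sum_in_ideal_def Left_of)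
  next
    case (Right_of l)
    have "plug n i C (free_sum n (Node l 0 t)) 1 \<in> QSym_plus n"
      using Cons.prems by (intro Cons.IH) (auto simp: Right_of)
    moreover have "free_sum n (Node l 0 t) = (\<lambda>m. \<Sum>k=m..n. X k * free_sum n l k * free_sum n t (Suc k))"
      by (simp add: fun_eq_iff)
    ultimately show ?thesis by (simp add: Right_of)
  qed
qed

text \<open>One enters a bounded subtree at its first node in inorder, descending along left
  children. That node has no left child, so its bound is its own label \<open>Suc i\<close>.\<close>

lemma plug_bounded_sum_in_ideal:
  assumes "t \<noteq> Leaf" "n \<le> i + size t + remaining C"
    and "\<And>i B l r C'. size r + remaining C' < size t + remaining C \<Longrightarrow> partial_sum_in_ideal n i B l r C'"
  shows "plug n (i + size t) C (bounded_sum n t (Suc i)) 1 \<in> QSym_plus n"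
  using assms
proof (induction t arbitrary: C)
  case Leaf
  then show ?case by simp
next
  case (Node l v r)
  show ?case
  proof (cases "l = Leaf")
    case True
    have "partial_sum_in_ideal n (Suc i) (Suc i) Leaf r C"
      using Node.prems(3) by simp
    moreover have "bounded_sum n (Node l v r) (Suc i) = partial_sum n (Suc i) (Suc i) Leaf r"
      by (simp add: True partial_sum_def fun_eq_iff)
    ultimately show ?thesis
      using Node.prems(2) by (simp add: partial_sum_in_ideal_def True)
  next
    case False
    have "plug n (i + size l) (Left_of r # C) (bounded_sum n l (Suc i)) 1 \<in> QSym_plus n"
      using Node.prems False by (intro Node.IH(1)) auto
    \<comment> \<open>The left subtree has the same bound \<open>Suc i\<close> as the root and
      larger or equal values, so the root's own bound may be dropped.\<close>
    moreover have "bounded_sum n (Node l v r) (Suc i) m =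
        (\<Sum>k=m..n. X k * bounded_sum n l (Suc i) k * bounded_sum n r (i + size l + 2) (Suc k))" for m
      using False by (auto intro!: sum.mono_neutral_left simp: bounded_sum_eq_0)
    then have "bounded_sum n (Node l v r) (Suc i) =
        (\<lambda>m. \<Sum>k=m..n. X k * bounded_sum n l (Suc i) k * bounded_sum n r (i + size l + 2) (Suc k))" ..
    ultimately show ?thesis by (simp add: add.assoc)
  qed
qed

text \<open>
  If the current node has a right child, its bound is implied by the one of the right subtree, and
  one passes to the next node in inorder. Otherwise one increases \<open>B\<close>; the difference factors through
  the tree from which the node and its left subtree have been removed.
\<close>

lemma partial_sum_in_ideal: "partial_sum_in_ideal n i B l r C"
\<comment> \<open>Lexicographic order: number of nodes still to come, depth of the context, distance
  from \<open>B\<close> to \<open>n\<close>. Raising \<open>B\<close> lowers only the last; removing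
  a node without right child below a \<open>Right_of\<close> frame lowers the second.\<close>
proof (induction "(i, B, l, r, C)" arbitrary: i B l r C
    rule: wf_induct_rule[OF wf_measures[of "[\<lambda>(i, B, l, r, C). size r + remaining C,
      \<lambda>(i, B, l, r, C). length C, \<lambda>(i, B, l, r, C). n - B]"]])
  case (1 i B l r C)
  have IH: "partial_sum_in_ideal n i' B' l' r' C'"
    if "size r' + remaining C' < size r + remaining C \<or>
      size r' + remaining C' = size r + remaining C \<and>
        (length C' < length C \<or> length C' = length C \<and> n - B' < n - B)" for i' B' l' r' C'
    using that by (intro 1) auto
  show ?case
    unfolding partial_sum_in_ideal_def
  proof (intro impI)
    assume iB: "i \<le> B" and n: "n \<le> i + size r + remaining C"
    consider "r \<noteq> Leaf" | "r = Leaf" "n \<le> B" | "r = Leaf" "B < n" by linarith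
    then show "plug n (i + size r) C (partial_sum n i B l r) 1 \<in> QSym_plus n"
    proof cases
      case 1
      have "partial_sum n i B l r m =
          (\<Sum>k=m..n. X k * free_sum n l k * bounded_sum n r (Suc i) (Suc k))" for m
        unfolding partial_sum_def using iB 1
        by (intro sum.mono_neutral_left) (auto simp: bounded_sum_eq_0)
      then have "partial_sum n i B l r =
          (\<lambda>m. \<Sum>k=m..n. X k * free_sum n l k * bounded_sum n r (Suc i) (Suc k))" ..
      moreover have "plug n (i + size r) (Right_of l # C) (bounded_sum n r (Suc i)) 1 \<in> QSym_plus n"
        using 1 n IH by (intro plug_bounded_sum_in_ideal) auto
      ultimately show ?thesis by simp
    next
      case 2
      have "partial_sum n i B l r = free_sum n (Node l 0 Leaf)"
        using 2 by (simp add: partial_sum_def fun_eq_iff min_def)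
      moreover have "plug n i C (free_sum n (Node l 0 Leaf)) 1 \<in> QSym_plus n"
        using 2 n IH by (intro plug_free_sum_in_ideal) auto
      ultimately show ?thesis using 2 by simp
    next
      case 3
      \<comment> \<open>\<open>g\<close> is the part of the summand \<open>k = Suc B\<close> coming
        from the node and its left subtree. All that the context still sees of them is the condition
        \<open>m \<le> Suc B\<close>, recorded by \<open>\<delta>\<close>.\<close>
      define g where "g = X (Suc B) * free_sum n l (Suc B)"
      define \<delta> :: "nat \<Rightarrow> qpoly" where "\<delta> m = (if m \<le> Suc B then 1 else 0)" for m
      have "partial_sum n i B l Leaf m = partial_sum n i (Suc B) l Leaf m - g * \<delta> m" for m
        using 3 by (simp add: partial_sum_def g_def \<delta>_def min_def)
      then have eq: "partial_sum n i B l Leaf = (\<lambda>m. partial_sum n i (Suc B) l Leaf m - g * \<delta> m)" ..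
      have "plug n i C (partial_sum n i B l Leaf) 1 =
          plug n i C (partial_sum n i (Suc B) l Leaf) 1 - g * plug n i C \<delta> 1"
        unfolding eq by (rule plug_diff_mult)
      moreover have "plug n i C (partial_sum n i (Suc B) l Leaf) 1 \<in> QSym_plus n"
        using IH[of Leaf C "Suc B" i l] 3 iB n by (simp add: partial_sum_in_ideal_def)
      moreover have "plug n i C \<delta> 1 \<in> QSym_plus n"
      proof (cases C)
        case Nil
        then show ?thesis using 3 iB n by simp
      next
        case (Cons fr C')
        show ?thesis
        proof (cases fr)
          case (Left_of r')
          \<comment> \<open>The parent has lost its left subtree and inherits the bound
            \<open>Suc B\<close>; it is the next node in inorder, with label
            \<open>Suc i\<close>.\<close>
          have "(\<Sum>k=m..n. X k * \<delta> k * bounded_sum n r' (i + 2) (Suc k)) =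
              partial_sum n (Suc i) (Suc B) Leaf r' m" for m
            unfolding partial_sum_def using 3
            by (intro sum.mono_neutral_cong_right) (auto simp: \<delta>_def)
          then show ?thesis
            using IH[of r' C' "Suc B" "Suc i" Leaf] 3 iB n
            by (simp add: partial_sum_in_ideal_def Cons Left_of add.commute)
        next
          case (Right_of l')
          \<comment> \<open>The strict increase turns \<open>Suc k \<le> Suc B\<close> into
            \<open>k \<le> B\<close>. In the smaller tree the parent takes over position
            \<open>i\<close>, as the following labels still start at \<open>Suc i\<close>.\<close>
          have "(\<Sum>k=m..n. X k * free_sum n l' k * \<delta> (Suc k)) = partial_sum n i B l' Leaf m" for m
            unfolding partial_sum_def using 3
            by (intro sum.mono_neutral_cong_right) (auto simp: \<delta>_def)
          then show ?thesis
            using IH[of Leaf C' B i l'] 3 iB n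
            by (simp add: partial_sum_in_ideal_def Cons Right_of)
        qed
      qed
      moreover have "g \<in> polys_upto n"
        unfolding g_def using 3 by (intro polys_upto_mult polys_upto_X polys_upto_free_sum) auto
      ultimately show ?thesis
        using 3 by (simp add: QSym_plus_diff QSym_plus_mult)
    qed
  qed
qed

lemma bounded_sum_in_QSym_plus:
  assumes "t \<noteq> Leaf" "n < s + size t" "1 \<le> s"
  shows "bounded_sum n t s 1 \<in> QSym_plus n"
  using plug_bounded_sum_in_ideal[of t n "s - 1" "[]"] assms partial_sum_in_ideal by simp


subsection \<open>Indexed forests\<close>

text \<open>An interval that started earlier or ended later than the other would contain a neighbour
  that the other's maximality excludes from \<open>S\<close>.\<close>

lemma blocks_disjoint:
  assumes "I \<in> blocks S" "J \<in> blocks S" "x \<in> I" "x \<in> J"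
  shows "I = J"
proof -
  obtain a b where I: "I = {a..b}" "{a..b} \<subseteq> S" "a - 1 \<notin> S" "b + 1 \<notin> S"
    using assms(1) by (auto simp: blocks_def)
  obtain a' b' where J: "J = {a'..b'}" "{a'..b'} \<subseteq> S" "a' - 1 \<notin> S" "b' + 1 \<notin> S"
    using assms(2) by (auto simp: blocks_def)
  have x: "a \<le> x" "x \<le> b" "a' \<le> x" "x \<le> b'" using I(1) J(1) assms(3,4) by auto
  have "a' - 1 \<in> {a..b}" if "a < a'" using that x by auto
  then have "\<not> a < a'" using I J by blast
  moreover have "a - 1 \<in> {a'..b'}" if "a' < a" using that x by auto
  then have "\<not> a' < a" using I J by blast
  moreover have "b + 1 \<in> {a'..b'}" if "b < b'" using that x by auto
  then have "\<not> b < b'" using I J by blast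
  moreover have "b' + 1 \<in> {a..b}" if "b' < b" using that x by auto
  then have "\<not> b' < b" using I J by blast
  ultimately show ?thesis using I J by auto
qed

lemma Union_blocks:
  assumes "finite S" "S \<subseteq> {1..}"
  shows "\<Union> (blocks S) = S"
proof
  show "\<Union> (blocks S) \<subseteq> S" by (auto simp: blocks_def)
  show "S \<subseteq> \<Union> (blocks S)"
  proof
    fix x assume x: "x \<in> S"
    define a where "a = (LEAST a. {a..x} \<subseteq> S)"
    have a: "{a..x} \<subseteq> S"
      unfolding a_def by (rule LeastI[of _ x]) (use x in auto)
    have ax: "a \<le> x"
      unfolding a_def by (rule Least_le) (use x in auto)
    then have "a \<in> S" using a by auto
    \<comment> \<open>Positivity makes the truncated difference \<open>a - 1\<close> a true
      predecessor.\<close>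
    then have "1 \<le> a" using assms(2) by auto
    have a1: "a - 1 \<notin> S"
    proof
      assume "a - 1 \<in> S"
      moreover have "{a - 1..x} = insert (a - 1) {a..x}"
        using \<open>1 \<le> a\<close> ax by auto
      ultimately have "{a - 1..x} \<subseteq> S" using a by simp
      then have "a \<le> a - 1"
        unfolding a_def by (rule Least_le)
      with \<open>1 \<le> a\<close> show False by simp
    qed
    define b where "b = Max {b\<in>S. {x..b} \<subseteq> S}"
    have "b \<in> {b\<in>S. {x..b} \<subseteq> S}"
      unfolding b_def using assms(1) x by (intro Max_in) auto
    then have b: "{x..b} \<subseteq> S" by auto
    have xb: "x \<le> b"
      unfolding b_def using assms(1) x by (intro Max_ge) auto
    have b1: "b + 1 \<notin> S"
    proof
      assume "b + 1 \<in> S"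
      moreover have "{x..b + 1} = insert (b + 1) {x..b}" using xb by auto
      ultimately have "b + 1 \<in> {b\<in>S. {x..b} \<subseteq> S}" using b by simp
      then have "b + 1 \<le> b"
        unfolding b_def using assms(1) by (intro Max_ge) auto
      then show False by simp
    qed
    have "{a..b} \<subseteq> S"
    proof
      fix y assume "y \<in> {a..b}"
      then show "y \<in> S" using a b by (cases "y \<le> x") auto
    qed
    then have "{a..b} \<in> blocks S"
      unfolding blocks_def using ax xb a1 b1 by (intro CollectI exI[of _ a] exI[of _ b]) auto
    then show "x \<in> \<Union> (blocks S)" using ax xb by (intro UnionI[of "{a..b}"]) auto
  qed
qed

lemma indexed_forest_on_IN: "indexed_forest_on S F \<Longrightarrow> IN F = S"
  using Union_blocks[of S] by (auto simp: indexed_forest_on_def bij_betw_def IN_def)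

lemma indexed_forest_on_tree:
  assumes "indexed_forest_on S F" "T \<in> F"
  obtains s where "1 \<le> s" "T \<noteq> Leaf" "inorder T = [s..<s + size T]"
proof -
  from assms have "set_tree T \<in> blocks S" and inorder: "inorder T = sorted_list_of_set (set_tree T)"
    by (auto simp: indexed_forest_on_def bij_betw_def)
  then obtain a b where ab: "a \<le> b" "set_tree T = {a..b}" "{a..b} \<subseteq> S"
    by (auto simp: blocks_def)
  have eq: "inorder T = [a..<Suc b]"
    using inorder ab sorted_list_of_set_range[of a "Suc b"] by (simp add: atLeastLessThanSuc_atLeastAtMost)
  then have "size T = Suc b - a"
    by (metis length_inorder length_upt)
  with ab eq have "inorder T = [a..<a + size T]" by simp
  moreover have "T \<noteq> Leaf" using ab by auto
  moreover have "a \<in> S" "S \<subseteq> {1..}"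
    using ab assms by (auto simp: indexed_forest_on_def)
  ultimately show ?thesis using that[of a] by auto
qed

lemma indexed_forest_on_disjoint:
  assumes "indexed_forest_on S F" "T \<in> F" "T' \<in> F" "x \<in> set_tree T" "x \<in> set_tree T'"
  shows "T = T'"
  using assms blocks_disjoint[of "set_tree T" S "set_tree T'" x]
  by (auto simp: indexed_forest_on_def bij_betw_def dest: inj_onD)

section \<open>Trees with consecutive labels and the values of rho\<close>

lemma set_tree_consecutive: "inorder t = [s..<s + size t] \<Longrightarrow> set_tree t = {s..<s + size t}"
  by (metis atLeastLessThan_upt set_inorder)

lemma inorder_consecutive_Node:
  assumes "inorder (Node l v r) = [s..<s + size (Node l v r)]"
  shows "inorder l = [s..<s + size l]" "v = s + size l"
    "inorder r = [Suc v..<Suc v + size r]"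
proof -
  have "[s..<s + size (Node l v r)] =
      [s..<s + size l] @ [s + size l] @ [Suc (s + size l)..<Suc (s + size l) + size r]"
    using upt_add_eq_append[of s "s + size l" "Suc (size r)"]
    by (simp add: upt_conv_Cons add.assoc del: upt_Suc)
  then show "inorder l = [s..<s + size l]" "v = s + size l" "inorder r = [Suc v..<Suc v + size r]"
    using assms by (auto simp del: upt_Suc)
qed

lemma consecutive_bst: "inorder t = [s..<s + size t] \<Longrightarrow> bst t"
  by (simp add: bst_iff_sorted_wrt_less)

lemma leftmost_eq_hd: "t \<noteq> Leaf \<Longrightarrow> leftmost t = hd (inorder t)"
  by (induction t rule: leftmost.induct) (auto simp: hd_append)

lemma leftmost_in_set_tree: "t \<noteq> Leaf \<Longrightarrow> leftmost t \<in> set_tree t"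
  using leftmost_eq_hd[of t] by (metis eq_inorder_Nil hd_in_set set_inorder)

lemma leftmost_le:
  assumes "bst t" "v \<in> set_tree t"
  shows "leftmost t \<le> v"
proof -
  obtain x xs where x: "inorder t = x # xs"
    using assms(2) by (cases "inorder t") auto
  then have "leftmost t = x"
    using leftmost_eq_hd[of t] by (cases t) auto
  moreover have "v \<in> set (x # xs)"
    using assms(2) by (simp flip: x)
  moreover have "sorted_wrt (<) (x # xs)"
    using assms(1) by (simp add: bst_iff_sorted_wrt_less flip: x)
  ultimately show ?thesis by auto
qed

lemma leftmost_consecutive:
  assumes "t \<noteq> Leaf" "inorder t = [s..<s + size t]"
  shows "leftmost t = s"
proof -
  have "0 < size t" using assms(1) by (cases t) auto
  then show ?thesis using assms by (simp add: leftmost_eq_hd)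
qed

lemma bst_subtree: "t' \<in> subtrees t \<Longrightarrow> bst t \<Longrightarrow> bst t'"
  by (induction t) auto

lemma set_subtree: "t' \<in> subtrees t \<Longrightarrow> set_tree t' \<subseteq> set_tree t"
  by (induction t) auto

lemma subtree_unique:
  assumes "bst t" "Node l v r \<in> subtrees t" "Node l' v r' \<in> subtrees t"
  shows "l = l' \<and> r = r'"
  using assms
proof (induction t)
  case (Node tl a tr)
  have sets: "v \<in> set_tree t'" if "Node x v y \<in> subtrees t'" for x y t'
    using that by (rule in_set_tree_if)
  consider "v = a" | "v < a" | "a < v" using linorder_cases[of v a] by blast
  then show ?case
  proof cases
    case 1
    then have "v \<notin> set_tree tl" "v \<notin> set_tree tr"
      using Node.prems(1) by auto
    then show ?thesis using Node.prems(2,3) sets by auto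
  next
    case 2
    then have "v \<notin> set_tree tr"
      using Node.prems(1) by auto
    then show ?thesis using 2 Node.prems Node.IH(1) by auto
  next
    case 3
    then have "v \<notin> set_tree tl"
      using Node.prems(1) by auto
    then show ?thesis using 3 Node.prems Node.IH(2) by auto
  qed
qed simp

text \<open>A label lies in one tree only and, by the search tree order, at one node of it; this
  resolves the definite description.\<close>

lemma rho_eq_leftmost:
  assumes F: "indexed_forest_on S F" and T: "T \<in> F" and sub: "Node l v r \<in> subtrees T"
  shows "rho F v = leftmost (Node l v r)"
  unfolding rho_def
proof (rule the_equality)
  show "\<exists>T\<in>F. \<exists>l' r'. Node l' v r' \<in> subtrees T \<and> leftmost (Node l v r) = leftmost (Node l' v r')"
    using T sub by blast
next
  fix i assume "\<exists>T\<in>F. \<exists>l r. Node l v r \<in> subtrees T \<and> i = leftmost (Node l v r)"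
  then obtain T' l' r' where T': "T' \<in> F" "Node l' v r' \<in> subtrees T'" "i = leftmost (Node l' v r')"
    by blast
  then have "T' = T"
    using indexed_forest_on_disjoint[OF F, of T' T v] T sub by (auto dest: in_set_tree_if)
  moreover have "bst T"
    using indexed_forest_on_tree[OF F T] consecutive_bst by metis
  ultimately show "i = leftmost (Node l v r)"
    using T' sub subtree_unique by blast
qed

lemma rho_in_tree:
  assumes F: "indexed_forest_on S F" and T: "T \<in> F" and v: "v \<in> set_tree T"
  shows "rho F v \<in> set_tree T" "rho F v \<le> v"
proof -
  obtain l r where sub: "Node l v r \<in> subtrees T"
    using set_treeE[OF v] by blast
  have rho: "rho F v = leftmost (Node l v r)"
    by (rule rho_eq_leftmost[OF F T sub])
  show "rho F v \<in> set_tree T"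
    unfolding rho using leftmost_in_set_tree[of "Node l v r"] set_subtree[OF sub] by auto
  have "bst (Node l v r)"
    using indexed_forest_on_tree[OF F T] consecutive_bst bst_subtree[OF sub] by metis
  then show "rho F v \<le> v"
    unfolding rho by (intro leftmost_le) auto
qed

lemma finite_IN: "indexed_forest_on S F \<Longrightarrow> finite (IN F)"
  using indexed_forest_on_IN[of S F] by (simp add: indexed_forest_on_def)

lemma sum_forest_code:
  assumes "finite (IN F)" "finite A"
  shows "(\<Sum>i\<in>A. forest_code F i) = card {v \<in> IN F. rho F v \<in> A}"
proof -
  have "(\<Sum>i\<in>A. forest_code F i) = card (\<Union>i\<in>A. {v \<in> IN F. rho F v = i})"
    unfolding forest_code_def using assms by (intro card_UN_disjoint[symmetric]) auto
  also have "(\<Union>i\<in>A. {v \<in> IN F. rho F v = i}) = {v \<in> IN F. rho F v \<in> A}" by auto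
  finally show ?thesis .
qed


subsection \<open>Labelings of forests\<close>

text \<open>The conditions of \<open>forest_labelings\<close> in recursive form; \<open>m\<close> is
  the lower bound that the parent imposes.\<close>

fun labels_tree :: "(nat \<Rightarrow> nat) \<Rightarrow> nat tree \<Rightarrow> nat \<Rightarrow> bool" where
  "labels_tree \<kappa> Leaf m \<longleftrightarrow> True"
| "labels_tree \<kappa> (Node l v r) m \<longleftrightarrow> m \<le> \<kappa> v \<and> \<kappa> v \<le> leftmost (Node l v r) \<and>
     labels_tree \<kappa> l (\<kappa> v) \<and> labels_tree \<kappa> r (Suc (\<kappa> v))"

lemma labels_tree_ge: "labels_tree \<kappa> t m \<Longrightarrow> v \<in> set_tree t \<Longrightarrow> m \<le> \<kappa> v"
proof (induction t arbitrary: m)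
  case (Node l u r)
  then show ?case using Node.IH(1)[of "\<kappa> u"] Node.IH(2)[of "Suc (\<kappa> u)"] by fastforce
qed simp

lemma labels_tree_le:
  "labels_tree \<kappa> t m \<Longrightarrow> Node l v r \<in> subtrees t \<Longrightarrow> \<kappa> v \<le> leftmost (Node l v r)"
  by (induction t arbitrary: m) auto

lemma labels_tree_left:
  "labels_tree \<kappa> t m \<Longrightarrow> Node (Node l v r) u r' \<in> subtrees t \<Longrightarrow> \<kappa> u \<le> \<kappa> v"
  by (induction t arbitrary: m) auto

lemma labels_tree_right:
  "labels_tree \<kappa> t m \<Longrightarrow> Node l u (Node l' v r) \<in> subtrees t \<Longrightarrow> \<kappa> u < \<kappa> v"
  by (induction t arbitrary: m) auto

lemma labels_treeI:
  assumes "\<And>l v r. t = Node l v r \<Longrightarrow> m \<le> \<kappa> v"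
    and "\<And>l v r. Node l v r \<in> subtrees t \<Longrightarrow> \<kappa> v \<le> leftmost (Node l v r)"
    and "\<And>l v r u r'. Node (Node l v r) u r' \<in> subtrees t \<Longrightarrow> \<kappa> u \<le> \<kappa> v"
    and "\<And>l u l' v r. Node l u (Node l' v r) \<in> subtrees t \<Longrightarrow> \<kappa> u < \<kappa> v"
  shows "labels_tree \<kappa> t m"
  using assms
proof (induction t arbitrary: m)
  case (Node l v r)
  have "labels_tree \<kappa> l (\<kappa> v)"
  proof (rule Node.IH(1))
    show "\<kappa> v \<le> \<kappa> w" if "l = Node l' w r'" for l' w r'
      using Node.prems(3)[of l' w r' v r] that by simp
    show "\<kappa> u \<le> \<kappa> w" if "Node (Node x w y) u z \<in> subtrees l" for x w y u z
      by (rule Node.prems(3)[of x w y u z]) (simp add: that)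
    show "\<kappa> u < \<kappa> w" if "Node x u (Node y w z) \<in> subtrees l" for x w y u z
      by (rule Node.prems(4)[of x u y w z]) (simp add: that)
  qed (simp add: Node.prems(2))
  moreover have "labels_tree \<kappa> r (Suc (\<kappa> v))"
  proof (rule Node.IH(2))
    show "Suc (\<kappa> v) \<le> \<kappa> w" if "r = Node l' w r'" for l' w r'
      using Node.prems(4)[of l v l' w r'] that by simp
    show "\<kappa> u \<le> \<kappa> w" if "Node (Node x w y) u z \<in> subtrees r" for x w y u z
      by (rule Node.prems(3)[of x w y u z]) (simp add: that)
    show "\<kappa> u < \<kappa> w" if "Node x u (Node y w z) \<in> subtrees r" for x w y u z
      by (rule Node.prems(4)[of x u y w z]) (simp add: that)
  qed (simp add: Node.prems(2))
  ultimately show ?case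
    using Node.prems(1)[of l v r] Node.prems(2)[of l v r] by simp
qed simp

lemma forest_labelings_eq:
  assumes F: "indexed_forest_on S F"
  shows "forest_labelings F = {\<kappa> \<in> extensional (IN F). \<forall>T\<in>F. labels_tree \<kappa> T 1}" (is "?L = ?R")
proof
  show "?L \<subseteq> ?R"
  proof
    fix \<kappa> assume "\<kappa> \<in> ?L"
    then have \<kappa>: "\<kappa> \<in> IN F \<rightarrow>\<^sub>E {1..}" "\<And>v. v \<in> IN F \<Longrightarrow> \<kappa> v \<le> rho F v"
      "\<And>u v. left_child F u v \<Longrightarrow> \<kappa> u \<le> \<kappa> v" "\<And>u v. right_child F u v \<Longrightarrow> \<kappa> u < \<kappa> v"
      by (auto simp: forest_labelings_def)
    have "labels_tree \<kappa> T 1" if T: "T \<in> F" for T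
    proof (rule labels_treeI)
      show "1 \<le> \<kappa> v" if "T = Node l v r" for l v r
        using \<kappa>(1) T that by (force simp: IN_def PiE_iff)
      show "\<kappa> v \<le> leftmost (Node l v r)" if sub: "Node l v r \<in> subtrees T" for l v r
        using \<kappa>(2)[of v] T rho_eq_leftmost[OF F T sub] in_set_tree_if[OF sub] by (auto simp: IN_def)
      show "\<kappa> u \<le> \<kappa> v" if "Node (Node l v r) u r' \<in> subtrees T" for l v r u r'
        using T that by (intro \<kappa>(3)) (auto simp: left_child_def)
      show "\<kappa> u < \<kappa> v" if "Node l u (Node l' v r) \<in> subtrees T" for l u l' v r
        using T that by (intro \<kappa>(4)) (auto simp: right_child_def)
    qed
    with \<kappa>(1) show "\<kappa> \<in> ?R" by (auto simp: PiE_def)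
  qed
  show "?R \<subseteq> ?L"
  proof
    fix \<kappa> assume \<kappa>: "\<kappa> \<in> ?R"
    have "1 \<le> \<kappa> v \<and> \<kappa> v \<le> rho F v" if v: "v \<in> IN F" for v
    proof -
      obtain T where T: "T \<in> F" "v \<in> set_tree T"
        using v by (auto simp: IN_def)
      obtain l r where sub: "Node l v r \<in> subtrees T"
        using set_treeE[OF T(2)] by blast
      show ?thesis
        using \<kappa> T labels_tree_ge[of \<kappa> T 1 v] labels_tree_le[OF _ sub, of \<kappa> 1] rho_eq_leftmost[OF F T(1) sub]
        by auto
    qed
    moreover have "\<kappa> u \<le> \<kappa> v" if "left_child F u v" for u v
      using that \<kappa> labels_tree_left by (fastforce simp: left_child_def)
    moreover have "\<kappa> u < \<kappa> v" if "right_child F u v" for u v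
      using that \<kappa> labels_tree_right by (fastforce simp: right_child_def)
    ultimately show "\<kappa> \<in> ?L"
      using \<kappa> by (auto simp: forest_labelings_def PiE_def)
  qed
qed

text \<open>\<open>extensional\<close> fixes the values outside \<open>A\<close>, so each labeling
  of \<open>A\<close> is counted once.\<close>

definition labeling_sum :: "nat set \<Rightarrow> ((nat \<Rightarrow> nat) \<Rightarrow> bool) \<Rightarrow> qpoly" where
  "labeling_sum A P = (\<Sum>\<kappa> | \<kappa> \<in> extensional A \<and> P \<kappa>. \<Prod>v\<in>A. X (\<kappa> v))"

text \<open>Restriction and gluing identify labelings of the union with pairs of labelings, and each
  condition reads only its own part.\<close>

lemma labeling_sum_Un:
  assumes fin: "finite A" "finite B" and disj: "A \<inter> B = {}"
    and P: "\<And>\<kappa> \<kappa>'. (\<And>v. v \<in> A \<Longrightarrow> \<kappa> v = \<kappa>' v) \<Longrightarrow> P \<kappa> = P \<kappa>'"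
    and Q: "\<And>\<kappa> \<kappa>'. (\<And>v. v \<in> B \<Longrightarrow> \<kappa> v = \<kappa>' v) \<Longrightarrow> Q \<kappa> = Q \<kappa>'"
  shows "labeling_sum (A \<union> B) (\<lambda>\<kappa>. P \<kappa> \<and> Q \<kappa>) = labeling_sum A P * labeling_sum B Q"
proof -
  let ?glue = "\<lambda>(\<kappa>, \<mu>) v. if v \<in> A then \<kappa> v else \<mu> v"
  let ?KA = "{\<kappa> \<in> extensional A. P \<kappa>}" and ?KB = "{\<kappa> \<in> extensional B. Q \<kappa>}"
  have "labeling_sum A P * labeling_sum B Q =
      (\<Sum>(\<kappa>, \<mu>)\<in>?KA \<times> ?KB. (\<Prod>v\<in>A. X (\<kappa> v)) * (\<Prod>v\<in>B. X (\<mu> v)))"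
    unfolding labeling_sum_def sum_product by (simp add: sum.cartesian_product)
  also have "\<dots> = (\<Sum>\<kappa> | \<kappa> \<in> extensional (A \<union> B) \<and> P \<kappa> \<and> Q \<kappa>. \<Prod>v\<in>A \<union> B. X (\<kappa> v))"
  proof (rule sum.reindex_bij_witness[of _ "\<lambda>\<kappa>. (restrict \<kappa> A, restrict \<kappa> B)" ?glue])
    fix p assume p: "p \<in> ?KA \<times> ?KB"
    obtain \<kappa> \<mu> where p_eq: "p = (\<kappa>, \<mu>)" by (cases p)
    have \<kappa>: "\<kappa> \<in> extensional A" "P \<kappa>" and \<mu>: "\<mu> \<in> extensional B" "Q \<mu>"
      using p by (auto simp: p_eq)
    have A: "?glue p v = \<kappa> v" if "v \<in> A" for v using that by (simp add: p_eq)
    have B: "?glue p v = \<mu> v" if "v \<in> B" for v using that disj by (auto simp: p_eq)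
    show "(restrict (?glue p) A, restrict (?glue p) B) = p"
      using \<kappa> \<mu> disj by (auto simp: p_eq fun_eq_iff restrict_def extensional_def)
    show "?glue p \<in> {\<kappa>. \<kappa> \<in> extensional (A \<union> B) \<and> P \<kappa> \<and> Q \<kappa>}"
      using \<kappa> \<mu> P[of "?glue p" \<kappa>, OF A] Q[of "?glue p" \<mu>, OF B]
      by (auto simp: p_eq extensional_def)
    have "(\<Prod>v\<in>A \<union> B. X (?glue p v)) = (\<Prod>v\<in>A. X (?glue p v)) * (\<Prod>v\<in>B. X (?glue p v))"
      using fin disj by (rule prod.union_disjoint)
    also have "\<dots> = (\<Prod>v\<in>A. X (\<kappa> v)) * (\<Prod>v\<in>B. X (\<mu> v))"
      by (simp only: A B cong: prod.cong)
    finally show "(\<Prod>v\<in>A \<union> B. X (?glue p v)) = (case p of (\<kappa>, \<mu>) \<Rightarrow> (\<Prod>v\<in>A. X (\<kappa> v)) * (\<Prod>v\<in>B. X (\<mu> v)))"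
      by (simp add: p_eq)
  next
    fix \<kappa> assume \<kappa>: "\<kappa> \<in> {\<kappa>. \<kappa> \<in> extensional (A \<union> B) \<and> P \<kappa> \<and> Q \<kappa>}"
    then show "?glue (restrict \<kappa> A, restrict \<kappa> B) = \<kappa>"
      by (auto simp: fun_eq_iff extensional_def)
    show "(restrict \<kappa> A, restrict \<kappa> B) \<in> ?KA \<times> ?KB"
      using \<kappa> P[of "restrict \<kappa> A" \<kappa>] Q[of "restrict \<kappa> B" \<kappa>] by auto
  qed
  finally show ?thesis by (simp add: labeling_sum_def)
qed

lemma labeling_sum_single: "labeling_sum {a} (\<lambda>\<kappa>. \<kappa> a = k) = X k"
proof -
  have "{\<kappa>. \<kappa> \<in> extensional {a} \<and> \<kappa> a = k} = {(\<lambda>v\<in>{a}. k)}"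
    by (auto simp: extensional_def fun_eq_iff)
  then show ?thesis by (simp add: labeling_sum_def)
qed

lemma labels_tree_cong: "(\<And>v. v \<in> set_tree t \<Longrightarrow> \<kappa> v = \<kappa>' v) \<Longrightarrow> labels_tree \<kappa> t m = labels_tree \<kappa>' t m"
  by (induction t arbitrary: m) auto

text \<open>Values are bounded by leftmost labels, hence by the largest label of the tree.\<close>

lemma finite_labels_tree: "finite {\<kappa>. \<kappa> \<in> extensional (set_tree t) \<and> labels_tree \<kappa> t m}"
proof (rule finite_subset)
  show "finite (set_tree t \<rightarrow>\<^sub>E {..Max (set_tree t)})"
    by (intro finite_PiE) auto
  show "{\<kappa>. \<kappa> \<in> extensional (set_tree t) \<and> labels_tree \<kappa> t m} \<subseteq> set_tree t \<rightarrow>\<^sub>E {..Max (set_tree t)}"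
  proof clarify
    fix \<kappa> assume \<kappa>: "\<kappa> \<in> extensional (set_tree t)" "labels_tree \<kappa> t m"
    have "\<kappa> v \<le> Max (set_tree t)" if v: "v \<in> set_tree t" for v
    proof -
      obtain l r where sub: "Node l v r \<in> subtrees t"
        using set_treeE[OF v] by blast
      have "leftmost (Node l v r) \<in> set_tree t"
        using leftmost_in_set_tree[of "Node l v r"] set_subtree[OF sub] by auto
      then show ?thesis
        using labels_tree_le[OF \<kappa>(2) sub] Max_ge[of "set_tree t"] by (meson finite_set_tree order_trans)
    qed
    with \<kappa> show "\<kappa> \<in> set_tree t \<rightarrow>\<^sub>E {..Max (set_tree t)}" by (auto simp: PiE_iff)
  qed
qed

definition tree_sum :: "nat tree \<Rightarrow> nat \<Rightarrow> qpoly" where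
  "tree_sum t m = labeling_sum (set_tree t) (\<lambda>\<kappa>. labels_tree \<kappa> t m)"

lemma tree_sum_Leaf: "tree_sum Leaf m = 1"
proof -
  have "{\<kappa> :: nat \<Rightarrow> nat. \<kappa> \<in> extensional {}} = {\<lambda>_. undefined}" by (auto simp: extensional_def)
  then show ?thesis by (simp add: tree_sum_def labeling_sum_def)
qed

lemma tree_sum_Node:
  assumes "bst (Node l a r)"
  shows "tree_sum (Node l a r) m =
    (\<Sum>k=m..leftmost (Node l a r). X k * tree_sum l k * tree_sum r (Suc k))"
proof -
  let ?s = "leftmost (Node l a r)" and ?A = "set_tree (Node l a r)"
  let ?K = "{\<kappa>. \<kappa> \<in> extensional ?A \<and> labels_tree \<kappa> (Node l a r) m}"
  \<comment> \<open>The labelings are grouped by the value \<open>k\<close> at the root; once it is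
    fixed, the two subtrees are independent.\<close>
  have "tree_sum (Node l a r) m = (\<Sum>k=m..?s. \<Sum>\<kappa> | \<kappa> \<in> ?K \<and> \<kappa> a = k. \<Prod>v\<in>?A. X (\<kappa> v))"
    unfolding tree_sum_def labeling_sum_def
    by (rule sum.group[symmetric]) (use finite_labels_tree[of "Node l a r" m] in auto)
  also have "\<dots> = (\<Sum>k=m..?s. X k * tree_sum l k * tree_sum r (Suc k))"
  proof (rule sum.cong)
    fix k assume k: "k \<in> {m..?s}"
    have "{\<kappa>. \<kappa> \<in> ?K \<and> \<kappa> a = k} = {\<kappa>. \<kappa> \<in> extensional ({a} \<union> (set_tree l \<union> set_tree r)) \<and>
        \<kappa> a = k \<and> labels_tree \<kappa> l k \<and> labels_tree \<kappa> r (Suc k)}"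
      using k by auto
    then have "(\<Sum>\<kappa> | \<kappa> \<in> ?K \<and> \<kappa> a = k. \<Prod>v\<in>?A. X (\<kappa> v)) =
        labeling_sum ({a} \<union> (set_tree l \<union> set_tree r))
          (\<lambda>\<kappa>. \<kappa> a = k \<and> labels_tree \<kappa> l k \<and> labels_tree \<kappa> r (Suc k))"
      by (simp add: labeling_sum_def Un_commute)
    also have "\<dots> = labeling_sum {a} (\<lambda>\<kappa>. \<kappa> a = k) *
        labeling_sum (set_tree l \<union> set_tree r) (\<lambda>\<kappa>. labels_tree \<kappa> l k \<and> labels_tree \<kappa> r (Suc k))"
    proof (rule labeling_sum_Un)
      show "(labels_tree \<kappa> l k \<and> labels_tree \<kappa> r (Suc k)) = (labels_tree \<kappa>' l k \<and> labels_tree \<kappa>' r (Suc k))"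
        if "\<And>v. v \<in> set_tree l \<union> set_tree r \<Longrightarrow> \<kappa> v = \<kappa>' v" for \<kappa> \<kappa>'
        using that by (metis UnI1 UnI2 labels_tree_cong)
    qed (use assms in auto)
    also have "labeling_sum (set_tree l \<union> set_tree r) (\<lambda>\<kappa>. labels_tree \<kappa> l k \<and> labels_tree \<kappa> r (Suc k)) =
        tree_sum l k * tree_sum r (Suc k)"
      unfolding tree_sum_def using assms
      by (intro labeling_sum_Un labels_tree_cong) fastforce+
    finally show "(\<Sum>\<kappa> | \<kappa> \<in> ?K \<and> \<kappa> a = k. \<Prod>v\<in>?A. X (\<kappa> v)) = X k * tree_sum l k * tree_sum r (Suc k)"
      by (simp add: labeling_sum_single mult.assoc)
  qed simp
  finally show ?thesis .
qed

text \<open>The leftmost label of a consecutively labeled tree is its first label \<open>s\<close>,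
  and the second assumption gives \<open>min s n = s\<close>.\<close>

lemma tree_sum_eq_bounded_sum:
  assumes "inorder t = [s..<s + size t]"
    and "\<And>l v r. Node l v r \<in> subtrees t \<Longrightarrow> leftmost (Node l v r) \<le> n"
  shows "tree_sum t m = bounded_sum n t s m"
  using assms
proof (induction t arbitrary: s m)
  case Leaf
  then show ?case by (simp add: tree_sum_Leaf)
next
  case (Node l v r)
  have s: "leftmost (Node l v r) = s"
    using Node.prems(1) by (intro leftmost_consecutive) simp_all
  moreover have "min s n = s"
    using Node.prems(2)[of l v r] s by simp
  moreover have "tree_sum l k = bounded_sum n l s k" for k
    using Node.prems inorder_consecutive_Node[OF Node.prems(1)] by (intro Node.IH) auto
  moreover have "tree_sum r k = bounded_sum n r (s + size l + 1) k" for k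
    using Node.prems inorder_consecutive_Node[OF Node.prems(1)] by (intro Node.IH) auto
  ultimately show ?case
    using tree_sum_Node[OF consecutive_bst[OF Node.prems(1)], of m] by simp
qed

text \<open>Trees share no labels and are labeled independently. It will therefore suffice to find a
  single tree whose sum lies in the ideal.\<close>

lemma forest_poly_factor:
  assumes F: "indexed_forest_on S F" and T: "T \<in> F"
  shows "forest_poly F = labeling_sum (IN (F - {T})) (\<lambda>\<kappa>. \<forall>T'\<in>F - {T}. labels_tree \<kappa> T' 1) * tree_sum T 1"
proof -
  have IN: "IN F = set_tree T \<union> IN (F - {T})"
    using T by (auto simp: IN_def)
  have "forest_poly F = labeling_sum (set_tree T \<union> IN (F - {T}))
      (\<lambda>\<kappa>. labels_tree \<kappa> T 1 \<and> (\<forall>T'\<in>F - {T}. labels_tree \<kappa> T' 1))"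
    unfolding forest_poly_def forest_labelings_eq[OF F] labeling_sum_def IN[symmetric]
    using T by (intro sum.cong) auto
  also have "\<dots> = tree_sum T 1 * labeling_sum (IN (F - {T})) (\<lambda>\<kappa>. \<forall>T'\<in>F - {T}. labels_tree \<kappa> T' 1)"
    unfolding tree_sum_def
  proof (rule labeling_sum_Un)
    show "finite (IN (F - {T}))"
      using finite_IN[OF F] IN by simp
    show "set_tree T \<inter> IN (F - {T}) = {}"
      using indexed_forest_on_disjoint[OF F T] by (auto simp: IN_def)
    show "(\<forall>T'\<in>F - {T}. labels_tree \<kappa> T' 1) = (\<forall>T'\<in>F - {T}. labels_tree \<kappa>' T' 1)"
      if "\<And>v. v \<in> IN (F - {T}) \<Longrightarrow> \<kappa> v = \<kappa>' v" for \<kappa> \<kappa>'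
      using that by (intro ball_cong refl labels_tree_cong) (auto simp: IN_def)
    show "labels_tree \<kappa> T 1 = labels_tree \<kappa>' T 1" if "\<And>v. v \<in> set_tree T \<Longrightarrow> \<kappa> v = \<kappa>' v" for \<kappa> \<kappa>'
      using that by (rule labels_tree_cong)
  qed simp
  finally show ?thesis by (simp add: mult.commute)
qed


subsection \<open>Forest polynomials and the ideal\<close>

lemma keys_prod_X: "keys (\<Prod>v\<in>A. X (\<kappa> v)) \<subseteq> {\<Sum>v\<in>A. single (\<kappa> v) 1}"
proof -
  have "(\<Prod>v\<in>A. X (\<kappa> v)) = single (\<Sum>v\<in>A. single (\<kappa> v) 1) 1"
    by (induction A rule: infinite_finite_induct) (simp_all add: X_def monomial_def mult_single)
  then show ?thesis by simp
qed

context
  fixes n :: nat and c :: expvec and S :: "nat set" and F :: "nat tree set"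
  assumes F: "indexed_forest_on S F" and code: "forest_code F = lookup c"
    and c: "keys c \<subseteq> {1..n}"
begin

text \<open>Every value of \<open>rho\<close> is a position at which the code is nonzero.\<close>

lemma rho_le_n:
  assumes "v \<in> IN F"
  shows "rho F v \<le> n"
proof -
  have "v \<in> {w \<in> IN F. rho F w = rho F v}" "finite {w \<in> IN F. rho F w = rho F v}"
    using assms finite_IN[OF F] by auto
  then have "forest_code F (rho F v) \<noteq> 0"
    unfolding forest_code_def by (metis card_eq_0_iff empty_iff)
  then have "rho F v \<in> keys c"
    by (simp add: code in_keys_iff)
  with c show ?thesis by auto
qed

lemma forest_poly_in_ABB_span:
  assumes "c \<in> ABB n"
  shows "keys (forest_poly F) \<subseteq> ABB n"
proof
  fix d assume "d \<in> keys (forest_poly F)"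
  then obtain \<kappa> where \<kappa>: "\<kappa> \<in> forest_labelings F" and "d \<in> keys (\<Prod>v\<in>IN F. X (\<kappa> v))"
    unfolding forest_poly_def using keys_sum[of "\<lambda>\<kappa>. \<Prod>v\<in>IN F. X (\<kappa> v)" "forest_labelings F"] by blast
  then have d: "d = (\<Sum>v\<in>IN F. single (\<kappa> v) 1)"
    using keys_prod_X by blast
  note fin = finite_IN[OF F]
  have \<kappa>_le: "1 \<le> \<kappa> v" "\<kappa> v \<le> rho F v" if "v \<in> IN F" for v
    using \<kappa> that by (auto simp: forest_labelings_def PiE_iff)
  have look: "lookup d j = card {v \<in> IN F. \<kappa> v = j}" for j
    using fin by (simp add: d lookup_sum lookup_single when_def sum.If_cases Int_def)
  have "keys d \<subseteq> {1..n}"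
  proof
    fix j assume "j \<in> keys d"
    then have "{v \<in> IN F. \<kappa> v = j} \<noteq> {}"
      using look[of j] by (auto simp only: in_keys_iff card.empty)
    then show "j \<in> {1..n}"
      using \<kappa>_le rho_le_n by force
  qed
  moreover have "(\<Sum>j=m..n. lookup d j) \<le> n - m" if m: "m \<in> {1..n}" for m
  proof -
    have "(\<Sum>j=m..n. lookup d j) = card (\<Union>j\<in>{m..n}. {v \<in> IN F. \<kappa> v = j})"
      unfolding look using fin by (intro card_UN_disjoint[symmetric]) auto
    \<comment> \<open>By \<open>\<kappa> v \<le> rho F v \<le> n\<close>, a node with value in
      \<open>{m..n}\<close> also has its \<open>rho\<close> there.\<close>
    also have "\<dots> \<le> card {v \<in> IN F. rho F v \<in> {m..n}}"
      using fin \<kappa>_le rho_le_n by (intro card_mono) (auto intro: order_trans)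
    also have "\<dots> = (\<Sum>j=m..n. lookup c j)"
      using sum_forest_code[OF fin, of "{m..n}"] by (simp add: code)
    also have "\<dots> \<le> n - m"
      using assms m by (simp add: ABB_iff)
    finally show ?thesis .
  qed
  ultimately show "d \<in> ABB n" by (simp add: ABB_iff)
qed

lemma forest_poly_in_QSym_plus:
  assumes "c \<notin> ABB n"
  shows "forest_poly F \<in> QSym_plus n"
proof -
  note fin = finite_IN[OF F]
  \<comment> \<open>If all labels were below \<open>n\<close>, the tail sum from \<open>m\<close>
    would count nodes \<open>v\<close> with \<open>m \<le> rho F v \<le> v < n\<close>, at most
    \<open>n - m\<close> of them, and \<open>c\<close> would be in ABB.\<close>
  have "\<exists>v\<in>IN F. n \<le> v"
  proof (rule ccontr)
    assume small: "\<not> (\<exists>v\<in>IN F. n \<le> v)"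
    have "(\<Sum>j=m..n. lookup c j) \<le> n - m" for m
    proof -
      have "(\<Sum>j=m..n. lookup c j) = card {v \<in> IN F. rho F v \<in> {m..n}}"
        using sum_forest_code[OF fin, of "{m..n}"] by (simp add: code)
      also have "\<dots> \<le> card {m..<n}"
      proof (rule card_mono)
        show "{v \<in> IN F. rho F v \<in> {m..n}} \<subseteq> {m..<n}"
          using small rho_in_tree(2)[OF F] by (fastforce simp: IN_def)
      qed simp
      finally show ?thesis by simp
    qed
    with c assms show False by (simp add: ABB_iff)
  qed
  then obtain v T where v: "n \<le> v" "T \<in> F" "v \<in> set_tree T"
    by (auto simp: IN_def)
  obtain s where s: "1 \<le> s" "T \<noteq> Leaf" "inorder T = [s..<s + size T]"
    using indexed_forest_on_tree[OF F v(2)] .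
  have "leftmost (Node l w r) \<le> n" if "Node l w r \<in> subtrees T" for l w r
    using that rho_eq_leftmost[OF F v(2) that] rho_le_n[of w] v(2) in_set_tree_if[OF that]
    by (auto simp: IN_def)
  then have "tree_sum T 1 = bounded_sum n T s 1"
    using s by (intro tree_sum_eq_bounded_sum) auto
  moreover have "bounded_sum n T s 1 \<in> QSym_plus n"
    using s v set_tree_consecutive[OF s(3)] by (intro bounded_sum_in_QSym_plus) auto
  \<comment> \<open>The other trees supply an admissible coefficient: their values are also at most
    \<open>rho\<close>, hence at most \<open>n\<close>.\<close>
  moreover have "labeling_sum (IN (F - {T})) (\<lambda>\<kappa>. \<forall>T'\<in>F - {T}. labels_tree \<kappa> T' 1) \<in> polys_upto n"
    unfolding labeling_sum_def
  proof (intro polys_upto_sum polys_upto_prod polys_upto_X)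
    fix \<kappa> w
    assume \<kappa>: "\<kappa> \<in> {\<kappa>. \<kappa> \<in> extensional (IN (F - {T})) \<and> (\<forall>T'\<in>F - {T}. labels_tree \<kappa> T' 1)}"
      and "w \<in> IN (F - {T})"
    then obtain T' where T': "T' \<in> F" "T' \<in> F - {T}" "w \<in> set_tree T'"
      by (auto simp: IN_def)
    obtain l r where sub: "Node l w r \<in> subtrees T'"
      using set_treeE[OF T'(3)] by blast
    have lab: "labels_tree \<kappa> T' 1" using \<kappa> T' by blast
    show "1 \<le> \<kappa> w" using labels_tree_ge[OF lab T'(3)] .
    have "w \<in> IN F" using T' by (auto simp: IN_def)
    then show "\<kappa> w \<le> n"
      using labels_tree_le[OF lab sub] rho_eq_leftmost[OF F T'(1) sub] rho_le_n by fastforce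
  qed
  ultimately show ?thesis
    by (simp add: forest_poly_factor[OF F v(2)] QSym_plus_mult)
qed

end


subsection \<open>Forests and their codes\<close>

fun tree_code :: "nat tree \<Rightarrow> nat \<Rightarrow> nat" where
  "tree_code Leaf i = 0"
| "tree_code (Node l v r) i =
     tree_code l i + tree_code r i + (if leftmost (Node l v r) = i then 1 else 0)"

lemma card_tree_code:
  assumes "bst t" "\<And>l v r. Node l v r \<in> subtrees t \<Longrightarrow> g v = leftmost (Node l v r)"
  shows "card {v \<in> set_tree t. g v = i} = tree_code t i"
  using assms
proof (induction t)
  case (Node l a r)
  let ?A = "{v \<in> set_tree l. g v = i}" and ?B = "{v \<in> set_tree r. g v = i}"
    and ?C = "{v. v = a \<and> g v = i}"
  have "card {v \<in> set_tree (Node l a r). g v = i} = card ((?A \<union> ?B) \<union> ?C)"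
    by (intro arg_cong[of _ _ card]) auto
  also have "\<dots> = card ?A + card ?B + card ?C"
    using Node.prems(1) by (subst card_Un_disjoint; (subst card_Un_disjoint)?) fastforce+
  also have "card ?A = tree_code l i"
    using Node by auto
  also have "card ?B = tree_code r i"
    using Node by auto
  also have "card ?C = (if leftmost (Node l a r) = i then 1 else 0)"
  proof -
    have "?C = (if leftmost (Node l a r) = i then {a} else {})"
      using Node.prems(2)[of l a r] by auto
    then show ?thesis by simp
  qed
  finally show ?case by simp
qed simp

lemma tree_code_notin: "j \<notin> set_tree t \<Longrightarrow> tree_code t j = 0"
proof (induction t)
  case (Node l v r)
  then show ?case using leftmost_in_set_tree[of "Node l v r"] by auto
qed simp

text \<open>\<open>rho\<close> never leaves a tree, so only nodes of \<open>T\<close> contribute at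
  a label of \<open>T\<close>.\<close>

lemma forest_code_eq_tree_code:
  assumes F: "indexed_forest_on S F" and T: "T \<in> F" and i: "i \<in> set_tree T"
  shows "forest_code F i = tree_code T i"
proof -
  have "{v \<in> IN F. rho F v = i} = {v \<in> set_tree T. rho F v = i}"
  proof (intro equalityI subsetI)
    fix v assume "v \<in> {v \<in> IN F. rho F v = i}"
    then obtain T' where T': "T' \<in> F" "v \<in> set_tree T'" "rho F v = i"
      by (auto simp: IN_def)
    then have "T' = T"
      using rho_in_tree(1)[OF F T'(1,2)] indexed_forest_on_disjoint[OF F T'(1) T] i by auto
    with T' show "v \<in> {v \<in> set_tree T. rho F v = i}" by simp
  qed (use T in \<open>auto simp: IN_def\<close>)
  moreover have "bst T"
    using indexed_forest_on_tree[OF F T] consecutive_bst by metis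
  ultimately show ?thesis
    using card_tree_code[of T "rho F" i] rho_eq_leftmost[OF F T] by (simp add: forest_code_def)
qed

lemma forest_code_notin:
  assumes F: "indexed_forest_on S F" and i: "i \<notin> S"
  shows "forest_code F i = 0"
proof -
  have "rho F v \<noteq> i" if "v \<in> IN F" for v
    using that i rho_in_tree(1)[OF F] indexed_forest_on_IN[OF F] by (auto simp: IN_def)
  then have "{v \<in> IN F. rho F v = i} = {}" by blast
  then show ?thesis unfolding forest_code_def by (simp only: card.empty)
qed

text \<open>The root contributes at the first label \<open>s\<close>, which is \<open>v\<close>
  itself exactly when there is no left subtree.\<close>

lemma tree_code_Node_consecutive:
  assumes "inorder (Node l v r) = [s..<s + size (Node l v r)]"
  shows "j < v \<Longrightarrow> tree_code (Node l v r) j = tree_code l j + (if j = s then 1 else 0)"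
    and "v < j \<Longrightarrow> tree_code (Node l v r) j = tree_code r j"
    and "tree_code (Node l v r) v = (if l = Leaf then 1 else 0)"
proof -
  note n = inorder_consecutive_Node[OF assms]
  have s: "leftmost (Node l v r) = s"
    using assms by (intro leftmost_consecutive) simp_all
  have l: "set_tree l = {s..<v}" and r: "set_tree r = {Suc v..<Suc v + size r}"
    using set_tree_consecutive[OF n(1)] set_tree_consecutive[OF n(3)] n(2) by auto
  show "tree_code (Node l v r) j = tree_code l j + (if j = s then 1 else 0)" if "j < v"
    using that s r by (simp add: tree_code_notin)
  show "tree_code (Node l v r) j = tree_code r j" if "v < j"
    using that s l n(2) by (simp add: tree_code_notin)
  show "tree_code (Node l v r) v = (if l = Leaf then 1 else 0)"
    using s l r n(2) by (simp add: tree_code_notin)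
qed

text \<open>
  The root of a tree is the first position at which the prefix sum of the code equals the length
  of the prefix.
\<close>

lemma sum_tree_code:
  assumes "inorder t = [s..<s + size t]"
  shows "(\<Sum>j=s..<s + size t. tree_code t j) = size t"
  using assms
proof (induction t arbitrary: s)
  case (Node l v r)
  note n = inorder_consecutive_Node[OF Node.prems]
  note code = tree_code_Node_consecutive[OF Node.prems]
  have "{s..<s + size (Node l v r)} = {s..<v} \<union> ({v} \<union> {Suc v..<Suc v + size r})"
    using n(2) by auto
  then have "(\<Sum>j=s..<s + size (Node l v r). tree_code (Node l v r) j) =
      (\<Sum>j=s..<v. tree_code (Node l v r) j) +
      (tree_code (Node l v r) v + (\<Sum>j=Suc v..<Suc v + size r. tree_code (Node l v r) j))"
    using n(2) by (simp add: sum.union_disjoint del: tree_code.simps)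
  also have "(\<Sum>j=s..<v. tree_code (Node l v r) j) = (\<Sum>j=s..<v. tree_code l j + (if j = s then 1 else 0))"
    by (intro sum.cong) (simp_all add: code del: tree_code.simps)
  also have "\<dots> = size l + (if l = Leaf then 0 else 1)"
    using Node.IH(1)[OF n(1)] n(2) by (simp add: sum.distrib sum.delta)
  also have "(\<Sum>j=Suc v..<Suc v + size r. tree_code (Node l v r) j) = (\<Sum>j=Suc v..<Suc v + size r. tree_code r j)"
    by (intro sum.cong) (simp_all add: code del: tree_code.simps)
  also have "\<dots> = size r"
    by (rule Node.IH(2)[OF n(3)])
  finally show ?case by (simp add: code del: tree_code.simps)
qed simp

text \<open>The root's contribution at \<open>s\<close> raises the nonempty prefix sums of
  \<open>l\<close> by one; with \<open>prefix_sum_ge\<close> they strictly exceed their lengths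
  before \<open>v\<close>, and equality holds at \<open>v\<close>.\<close>

lemma prefix_sum_Node:
  assumes "inorder (Node l v r) = [s..<s + size (Node l v r)]"
  shows "(\<Sum>j=s..<Suc v. tree_code (Node l v r) j) = Suc (size l)"
    and "0 < k \<Longrightarrow> k \<le> size l \<Longrightarrow>
      (\<Sum>j=s..<s + k. tree_code (Node l v r) j) = Suc (\<Sum>j=s..<s + k. tree_code l j)"
proof -
  note n = inorder_consecutive_Node[OF assms]
  note code = tree_code_Node_consecutive[OF assms]
  have pre: "(\<Sum>j=s..<s + k. tree_code (Node l v r) j) =
      (\<Sum>j=s..<s + k. tree_code l j) + (if 0 < k then 1 else 0)" if "k \<le> size l" for k
  proof -
    have "(\<Sum>j=s..<s + k. tree_code (Node l v r) j) =
        (\<Sum>j=s..<s + k. tree_code l j + (if j = s then 1 else 0))"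
    proof (rule sum.cong)
      show "tree_code (Node l v r) j = tree_code l j + (if j = s then 1 else 0)" if "j \<in> {s..<s + k}" for j
        using that \<open>k \<le> size l\<close> n(2) by (intro code(1)) simp
    qed simp
    then show ?thesis by (simp add: sum.distrib sum.delta)
  qed
  then show "(\<Sum>j=s..<s + k. tree_code (Node l v r) j) = Suc (\<Sum>j=s..<s + k. tree_code l j)"
    if "0 < k" "k \<le> size l" using that by simp
  have "(\<Sum>j=s..<Suc v. tree_code (Node l v r) j) =
      (\<Sum>j=s..<s + size l. tree_code (Node l v r) j) + tree_code (Node l v r) v"
    using n(2) by (simp del: tree_code.simps)
  also have "\<dots> = Suc (size l)"
    using pre[of "size l"] sum_tree_code[OF n(1)] by (simp add: code del: tree_code.simps)
  finally show "(\<Sum>j=s..<Suc v. tree_code (Node l v r) j) = Suc (size l)" .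
qed

lemma prefix_sum_ge:
  assumes "inorder t = [s..<s + size t]" "k \<le> size t"
  shows "k \<le> (\<Sum>j=s..<s + k. tree_code t j)"
  using assms
proof (induction t arbitrary: s k)
  case (Node l v r)
  note n = inorder_consecutive_Node[OF Node.prems(1)]
  note code = tree_code_Node_consecutive[OF Node.prems(1)]
  consider "k = 0" | "0 < k" "k \<le> size l" | "size l < k" by linarith
  then show ?case
  proof cases
    case 2
    then show ?thesis
      using prefix_sum_Node(2)[OF Node.prems(1) 2] Node.IH(1)[OF n(1) 2(2)] by linarith
  next
    case 3
    then obtain k' where k: "k = Suc (size l) + k'"
      using less_iff_Suc_add by auto
    then have eq: "s + k = Suc v + k'" "k' \<le> size r" using n(2) Node.prems(2) by auto
    have "(\<Sum>j=s..<Suc v + k'. tree_code (Node l v r) j) =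
        (\<Sum>j=s..<Suc v. tree_code (Node l v r) j) + (\<Sum>j=Suc v..<Suc v + k'. tree_code (Node l v r) j)"
      using n(2) by (intro sum.atLeastLessThan_concat[symmetric]) auto
    also have "(\<Sum>j=Suc v..<Suc v + k'. tree_code (Node l v r) j) = (\<Sum>j=Suc v..<Suc v + k'. tree_code r j)"
      by (intro sum.cong) (simp_all add: code del: tree_code.simps)
    finally show ?thesis
      unfolding eq(1) using Node.IH(2)[OF n(3) eq(2)] prefix_sum_Node(1)[OF Node.prems(1)] k by linarith
  qed simp
qed simp

lemma tree_code_inj:
  assumes "inorder t = [s..<s + size t]" "inorder t' = [s..<s + size t']" "size t = size t'"
    and "\<And>j. tree_code t j = tree_code t' j"
  shows "t = t'"
  using assms
proof (induction t arbitrary: s t')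
  case (Node l v r)
  obtain l' v' r' where t': "t' = Node l' v' r'"
    using Node.prems(3) by (cases t') auto
  note n = inorder_consecutive_Node[OF Node.prems(1)]
  note n' = inorder_consecutive_Node[OF Node.prems(2)[unfolded t']]
  note code = tree_code_Node_consecutive[OF Node.prems(1)]
  note code' = tree_code_Node_consecutive[OF Node.prems(2)[unfolded t']]
  have eq: "tree_code (Node l v r) j = tree_code (Node l' v' r') j" for j
    using Node.prems(4)[of j] unfolding t' .
  \<comment> \<open>With a shorter \<open>l\<close>, the prefix of length
    \<open>Suc (size l)\<close> would have sum equal to its length in one tree and a larger sum in
    the other.\<close>
  have "\<not> size l < size l'"
  proof
    assume less: "size l < size l'"
    have "Suc (Suc (size l)) \<le> (\<Sum>j=s..<s + Suc (size l). tree_code (Node l' v' r') j)"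
      using prefix_sum_Node(2)[OF Node.prems(2)[unfolded t'], of "Suc (size l)"]
        prefix_sum_ge[OF n'(1), of "Suc (size l)"] less by linarith
    also have "\<dots> = Suc (size l)"
      using prefix_sum_Node(1)[OF Node.prems(1)] n(2) unfolding eq by simp
    finally show False by simp
  qed
  moreover have "\<not> size l' < size l"
  proof
    assume less: "size l' < size l"
    have "Suc (Suc (size l')) \<le> (\<Sum>j=s..<s + Suc (size l'). tree_code (Node l v r) j)"
      using prefix_sum_Node(2)[OF Node.prems(1), of "Suc (size l')"]
        prefix_sum_ge[OF n(1), of "Suc (size l')"] less by linarith
    also have "\<dots> = Suc (size l')"
      using prefix_sum_Node(1)[OF Node.prems(2)[unfolded t']] n'(2) unfolding eq by simp
    finally show False by simp
  qed
  ultimately have size_l: "size l = size l'" by simp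
  then have size_r: "size r = size r'" and v: "v = v'"
    using Node.prems(3) n(2) n'(2) by (auto simp: t')
  have code_l: "tree_code l j = tree_code l' j" for j
  proof (cases "j < v")
    case True
    then show ?thesis using code(1)[of j] code'(1)[of j] eq[of j] v by linarith
  next
    case False
    then show ?thesis
      using set_tree_consecutive[OF n(1)] set_tree_consecutive[OF n'(1)] n(2) n'(2) v
      by (simp add: tree_code_notin)
  qed
  have code_r: "tree_code r j = tree_code r' j" for j
  proof (cases "v < j")
    case True
    then show ?thesis using code(2)[of j] code'(2)[of j] eq[of j] v by linarith
  next
    case False
    then show ?thesis
      using set_tree_consecutive[OF n(3)] set_tree_consecutive[OF n'(3)] v
      by (simp add: tree_code_notin)
  qed
  show ?case
    using Node.IH(1)[OF n(1) n'(1) size_l code_l] Node.IH(2)[OF n(3) n'(3)[folded v] size_r code_r]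
    by (simp add: v t')
qed simp

lemma tree_code_surj:
  assumes "\<And>k. k \<le> N \<Longrightarrow> k \<le> (\<Sum>j=s..<s + k. c j)" "(\<Sum>j=s..<s + N. c j) = N"
  shows "\<exists>t. inorder t = [s..<s + N] \<and> (\<forall>j\<in>{s..<s + N}. tree_code t j = c j)"
  using assms
proof (induction N arbitrary: s c rule: less_induct)
  case (less N)
  show ?case
  proof (cases "N = 0")
    case True
    then show ?thesis by (intro exI[of _ Leaf]) simp
  next
    case False
    \<comment> \<open>The first balanced prefix: it must consist of the left subtree and the root,
      so the root will be at \<open>s + m\<close> with \<open>p = Suc m\<close>.\<close>
    define p where "p = (LEAST k. 0 < k \<and> (\<Sum>j=s..<s + k. c j) = k)"
    have N: "0 < N \<and> (\<Sum>j=s..<s + N. c j) = N"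
      using False less.prems(2) by simp
    have p: "0 < p \<and> (\<Sum>j=s..<s + p. c j) = p"
      unfolding p_def by (rule LeastI[of "\<lambda>k. 0 < k \<and> (\<Sum>j=s..<s + k. c j) = k", OF N])
    have "p \<le> N"
      unfolding p_def by (rule Least_le[of "\<lambda>k. 0 < k \<and> (\<Sum>j=s..<s + k. c j) = k", OF N])
    have before: "k < (\<Sum>j=s..<s + k. c j)" if "0 < k" "k < p" for k
    proof -
      have "(\<Sum>j=s..<s + k. c j) \<noteq> k"
        using not_less_Least[OF that(2)[unfolded p_def]] that(1) by blast
      moreover have "k \<le> (\<Sum>j=s..<s + k. c j)"
        using less.prems(1)[of k] that(2) \<open>p \<le> N\<close> by simp
      ultimately show ?thesis by simp
    qed
    obtain m where m: "p = Suc m" using p by (cases p) auto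
    \<comment> \<open>The code of the left subtree: the root's unit at \<open>s\<close> is taken
      away. Strict excess before \<open>p\<close> leaves enough for the prefix condition.\<close>
    define c' where "c' j = c j - (if j = s then 1 else 0)" for j
    have "\<exists>l. inorder l = [s..<s + m] \<and> (\<forall>j\<in>{s..<s + m}. tree_code l j = c' j)"
    proof (rule less.IH)
      show "m < N" using m \<open>p \<le> N\<close> by simp
      have "1 \<le> c s" using less.prems(1)[of 1] False by simp
      have c': "Suc (\<Sum>j=s..<s + k. c' j) = (\<Sum>j=s..<s + k. c j)" if "0 < k" for k
      proof -
        have "(\<Sum>j=s..<s + k. c j) = (\<Sum>j=s..<s + k. c' j + (if j = s then 1 else 0))"
          using \<open>1 \<le> c s\<close> by (intro sum.cong) (auto simp: c'_def)
        then show ?thesis using that by (simp add: sum.distrib sum.delta)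
      qed
      show "k \<le> (\<Sum>j=s..<s + k. c' j)" if "k \<le> m" for k
        using c'[of k] before[of k] that m by (cases "k = 0") auto
      show "(\<Sum>j=s..<s + m. c' j) = m"
        using c'[of m] before[of m] p m by (cases "m = 0") auto
    qed
    then obtain l where l: "inorder l = [s..<s + m]" "\<And>j. j \<in> {s..<s + m} \<Longrightarrow> tree_code l j = c' j"
      by blast
    have split: "(\<Sum>j=s + p..<s + p + k. c j) = (\<Sum>j=s..<s + (p + k). c j) - p" for k
      using sum.atLeastLessThan_concat[of s "s + p" "s + p + k" c] p by (simp add: add.assoc)
    have "\<exists>r. inorder r = [s + p..<s + p + (N - p)] \<and> (\<forall>j\<in>{s + p..<s + p + (N - p)}. tree_code r j = c j)"
    proof (rule less.IH)
      show "N - p < N" using p \<open>p \<le> N\<close> by simp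
      show "k \<le> (\<Sum>j=s + p..<s + p + k. c j)" if "k \<le> N - p" for k
        using less.prems(1)[of "p + k"] that \<open>p \<le> N\<close> unfolding split by linarith
      show "(\<Sum>j=s + p..<s + p + (N - p). c j) = N - p"
        unfolding split using less.prems(2) \<open>p \<le> N\<close> by simp
    qed
    then obtain r where r: "inorder r = [s + p..<s + N]" "\<And>j. j \<in> {s + p..<s + N} \<Longrightarrow> tree_code r j = c j"
      using \<open>p \<le> N\<close> by auto
    let ?t = "Node l (s + m) r"
    have "[s..<s + N] = [s..<s + m] @ [s + m..<s + N]"
      using upt_add_eq_append[of s "s + m" "N - m"] m \<open>p \<le> N\<close> by simp
    also have "[s + m..<s + N] = (s + m) # [s + p..<s + N]"
      using m \<open>p \<le> N\<close> by (simp add: upt_conv_Cons)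
    finally have t: "inorder ?t = [s..<s + N]" using l r by simp
    have "size ?t = N" using arg_cong[OF t, of length] by (simp only: length_inorder length_upt)
    then have t': "inorder ?t = [s..<s + size ?t]" using t by simp
    have "tree_code ?t j = c j" if j: "j \<in> {s..<s + N}" for j
    proof -
      consider "j < s + m" | "j = s + m" | "s + m < j" by linarith
      then show ?thesis
      proof cases
        case 1
        have "1 \<le> c s" using less.prems(1)[of 1] False by simp
        with 1 show ?thesis
          using tree_code_Node_consecutive(1)[OF t' 1] l(2)[of j] j by (auto simp: c'_def)
      next
        case 2
        have "length (inorder l) = m" using l(1) by simp
        then have "size l = m" by simp
        then have "l = Leaf \<longleftrightarrow> m = 0" by auto
        moreover have "(\<Sum>j=s..<s + p. c j) = (\<Sum>j=s..<s + m. c j) + c (s + m)"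
          by (simp add: m)
        \<comment> \<open>For \<open>m > 0\<close> the prefix of length \<open>m\<close> already has
          sum at least \<open>Suc m\<close>, the sum of the prefix of length \<open>p\<close>, so
          nothing is left at the root position.\<close>
        then have "c (s + m) = (if m = 0 then 1 else 0)"
          using before[of m] p m by (cases "m = 0") auto
        ultimately show ?thesis
          using tree_code_Node_consecutive(3)[OF t'] 2 by simp
      next
        case 3
        then show ?thesis
          using tree_code_Node_consecutive(2)[OF t' 3] r(2)[of j] j m by simp
      qed
    qed
    with t show ?thesis by blast
  qed
qed

text \<open>
  If \<open>i\<close> lies in the block starting at \<open>a\<close>, the nodes \<open>a, \<dots>, i\<close> all have \<open>\<rho>\<close>-value in \<open>{a..i}\<close>. If \<open>i\<close> is not in
  the support, only nodes in \<open>{a..<i}\<close> can have such a value.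
\<close>

definition code_support :: "(nat \<Rightarrow> nat) \<Rightarrow> nat set" where
  "code_support c = {i. \<exists>a. 1 \<le> a \<and> a \<le> i \<and> Suc i - a \<le> (\<Sum>j=a..i. c j)}"

lemma support_eq_code_support:
  assumes F: "indexed_forest_on S F"
  shows "S = code_support (forest_code F)"
proof (intro equalityI subsetI)
  note fin = finite_IN[OF F]
  fix i assume "i \<in> S"
  then obtain T where T: "T \<in> F" "i \<in> set_tree T"
    using indexed_forest_on_IN[OF F] by (auto simp: IN_def)
  obtain s where s: "1 \<le> s" "T \<noteq> Leaf" "inorder T = [s..<s + size T]"
    using indexed_forest_on_tree[OF F T(1)] .
  have set_T: "set_tree T = {s..<s + size T}"
    by (rule set_tree_consecutive[OF s(3)])
  have "{s..i} \<subseteq> {v \<in> IN F. rho F v \<in> {s..i}}"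
  proof
    fix v assume v: "v \<in> {s..i}"
    then have vT: "v \<in> set_tree T" using T(2) set_T by auto
    then have "v \<in> IN F" using T(1) by (auto simp: IN_def)
    with rho_in_tree[OF F T(1) vT] v show "v \<in> {v \<in> IN F. rho F v \<in> {s..i}}"
      by (simp add: set_T)
  qed
  then have "card {s..i} \<le> (\<Sum>j=s..i. forest_code F j)"
    unfolding sum_forest_code[OF fin finite_atLeastAtMost] using fin by (intro card_mono) auto
  then show "i \<in> code_support (forest_code F)"
    using s(1) T(2) set_T by (auto simp: code_support_def)
next
  note fin = finite_IN[OF F]
  fix i assume "i \<in> code_support (forest_code F)"
  then obtain a where a: "1 \<le> a" "a \<le> i" "Suc i - a \<le> (\<Sum>j=a..i. forest_code F j)"
    by (auto simp: code_support_def)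
  show "i \<in> S"
  proof (rule ccontr)
    assume i: "i \<notin> S"
    have "{v \<in> IN F. rho F v \<in> {a..i}} \<subseteq> {a..<i}"
    proof
      fix v assume v: "v \<in> {v \<in> IN F. rho F v \<in> {a..i}}"
      then obtain T where T: "T \<in> F" "v \<in> set_tree T" by (auto simp: IN_def)
      obtain s where s: "1 \<le> s" "T \<noteq> Leaf" "inorder T = [s..<s + size T]"
        using indexed_forest_on_tree[OF F T(1)] .
      have "i \<notin> set_tree T"
        using T(1) i indexed_forest_on_IN[OF F] by (auto simp: IN_def)
      then show "v \<in> {a..<i}"
        using v T(2) rho_in_tree[OF F T] set_tree_consecutive[OF s(3)] by auto
    qed
    then have "card {v \<in> IN F. rho F v \<in> {a..i}} \<le> i - a"
      using card_mono[of "{a..<i}"] by fastforce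
    with a show False
      using fin by (simp add: sum_forest_code)
  qed
qed

text \<open>The code determines the support, hence the blocks and the label set of each tree; on
  each block \<open>tree_code_inj\<close> recovers the tree.\<close>

lemma forest_code_inj:
  assumes F: "indexed_forest_on S F" and F': "indexed_forest_on S' F'"
    and code: "forest_code F = forest_code F'"
  shows "F = F'"
proof -
  have sub: "F\<^sub>1 \<subseteq> F\<^sub>2"
    if F1: "indexed_forest_on S\<^sub>1 F\<^sub>1" and F2: "indexed_forest_on S\<^sub>2 F\<^sub>2" and code: "forest_code F\<^sub>1 = forest_code F\<^sub>2"
    for F\<^sub>1 F\<^sub>2 S\<^sub>1 S\<^sub>2
  proof
    fix T assume T: "T \<in> F\<^sub>1"
    have "S\<^sub>1 = S\<^sub>2"
      using support_eq_code_support[OF F1] support_eq_code_support[OF F2] code by simp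
    then have "set_tree T \<in> set_tree ` F\<^sub>2"
      using F1 F2 T by (auto simp: indexed_forest_on_def bij_betw_def)
    then obtain T' where T': "T' \<in> F\<^sub>2" "set_tree T' = set_tree T" by auto
    then have inorder: "inorder T = inorder T'"
      using F1 F2 T by (auto simp: indexed_forest_on_def)
    obtain s where s: "inorder T = [s..<s + size T]"
      using indexed_forest_on_tree[OF F1 T] by blast
    have "size T = size T'"
      using arg_cong[OF inorder, of length] by simp
    moreover have "tree_code T j = tree_code T' j" for j
      using forest_code_eq_tree_code[OF F1 T] forest_code_eq_tree_code[OF F2 T'(1)] code T'(2)
      by (cases "j \<in> set_tree T") (auto simp: tree_code_notin)
    ultimately have "T = T'"
      using s inorder by (intro tree_code_inj[of T s T']) simp_all
    with T' show "T \<in> F\<^sub>2" by simp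
  qed
  show ?thesis
    using sub[OF F F' code] sub[OF F' F code[symmetric]] by auto
qed

text \<open>Supplies, for a maximal interval of the code support, the two balance conditions that
  \<open>tree_code_surj\<close> needs.\<close>

lemma block_code:
  assumes "1 \<le> a" "a \<le> b" "{a..b} \<subseteq> code_support c" "a - 1 \<notin> code_support c" "b + 1 \<notin> code_support c"
  shows "k \<le> Suc b - a \<Longrightarrow> k \<le> (\<Sum>j=a..<a + k. c j)"
    and "(\<Sum>j=a..<a + (Suc b - a). c j) = Suc b - a"
proof -
  show pre: "k \<le> (\<Sum>j=a..<a + k. c j)" if "k \<le> Suc b - a" for k
    using that
  proof (induction k rule: less_induct)
    case (less k)
    show ?case
    proof (cases "k = 0")
      case False
      define i where "i = a + k - 1"
      have i: "a + k = Suc i" "a \<le> i" "i \<le> b"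
        using False less.prems assms(2) by (auto simp: i_def)
      then have "i \<in> code_support c" using assms(3) by auto
      then obtain a' where a': "1 \<le> a'" "a' \<le> i" "Suc i - a' \<le> (\<Sum>j=a'..<Suc i. c j)"
        by (auto simp: code_support_def atLeastLessThanSuc_atLeastAtMost)
      show ?thesis
      proof (cases "a \<le> a'")
        \<comment> \<open>The witness starts inside the block: its excess is combined with the
          prefix up to \<open>a'\<close>, which is covered by induction.\<close>
        case True
        have "a' - a \<le> (\<Sum>j=a..<a + (a' - a). c j)"
          using less.IH[of "a' - a"] less.prems a' i True by simp
        moreover have "(\<Sum>j=a..<Suc i. c j) = (\<Sum>j=a..<a'. c j) + (\<Sum>j=a'..<Suc i. c j)"
          using True a' by (simp add: sum.atLeastLessThan_concat)
        ultimately show ?thesis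
          unfolding i(1) using a' i True by simp
      next
        \<comment> \<open>The witness starts before the block. As \<open>a - 1\<close> is outside
          the support, the part before \<open>a\<close> falls short of its length, so the rest must
          make up for it.\<close>
        case False
        then have "\<not> Suc (a - 1) - a' \<le> (\<Sum>j=a'..a - 1. c j)"
          using assms(1,4) a'(1) by (auto simp: code_support_def)
        moreover have "{a'..a - 1} = {a'..<a}" using assms(1) by auto
        ultimately have "(\<Sum>j=a'..<a. c j) < a - a'"
          using assms(1) by simp
        moreover have "(\<Sum>j=a'..<Suc i. c j) = (\<Sum>j=a'..<a. c j) + (\<Sum>j=a..<Suc i. c j)"
          using False i by (simp add: sum.atLeastLessThan_concat)
        ultimately show ?thesis
          unfolding i(1) using a' i False by linarith
      qed
    qed simp
  qed
  \<comment> \<open>As \<open>b + 1\<close> is outside the support, the sum up to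
    \<open>b + 1\<close> is at most \<open>Suc b - a\<close>.\<close>
  have "\<not> Suc (b + 1) - a \<le> (\<Sum>j=a..b + 1. c j)"
    using assms(1,2,5) by (auto simp: code_support_def)
  moreover have "(\<Sum>j=a..<Suc b. c j) \<le> (\<Sum>j=a..b + 1. c j)"
    by (intro sum_mono2) auto
  ultimately have "(\<Sum>j=a..<Suc b. c j) \<le> Suc b - a"
    using assms(2) by simp
  then show "(\<Sum>j=a..<a + (Suc b - a). c j) = Suc b - a"
    using pre[of "Suc b - a"] assms(2) by simp
qed

lemma forest_code_surj:
  assumes c: "keys c \<subseteq> {1..n}"
  shows "\<exists>S F. indexed_forest_on S F \<and> forest_code F = lookup c"
proof -
  let ?c = "lookup c"
  define S where "S = code_support ?c"
  have S1: "S \<subseteq> {1..}" by (auto simp: S_def code_support_def)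
  have zero: "?c j = 0" if "j \<notin> {1..n}" for j
    using c that by (auto simp: in_keys_iff subset_iff)
  \<comment> \<open>A witness \<open>a\<close> is at most \<open>n\<close>, since the code vanishes
    beyond \<open>n\<close>, and the interval from \<open>a\<close> to \<open>i\<close> is no longer
    than the total of the code.\<close>
  have "S \<subseteq> {..n + (\<Sum>j=1..n. ?c j)}"
  proof
    fix i assume "i \<in> S"
    then obtain a where a: "1 \<le> a" "a \<le> i" "Suc i - a \<le> (\<Sum>j=a..i. ?c j)"
      by (auto simp: S_def code_support_def)
    have "a \<le> n"
    proof (rule ccontr)
      assume "\<not> a \<le> n"
      then have "(\<Sum>j=a..i. ?c j) = 0" by (intro sum.neutral) (simp add: zero)
      with a show False by simp
    qed
    moreover have "(\<Sum>j=a..i. ?c j) \<le> (\<Sum>j\<in>{a..i} \<inter> {1..n}. ?c j)"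
      by (rule eq_refl, rule sum.mono_neutral_right) (auto simp: zero simp del: One_nat_def)
    moreover have "(\<Sum>j\<in>{a..i} \<inter> {1..n}. ?c j) \<le> (\<Sum>j=1..n. ?c j)"
      by (rule sum_mono2) auto
    ultimately show "i \<in> {..n + (\<Sum>j=1..n. ?c j)}" using a by simp
  qed
  then have finS: "finite S" by (rule finite_subset) simp
  have "\<exists>T. set_tree T = I \<and> inorder T = sorted_list_of_set I \<and> (\<forall>j\<in>I. tree_code T j = ?c j)"
    if I: "I \<in> blocks S" for I
  proof -
    obtain a b where ab: "I = {a..b}" "a \<le> b" "{a..b} \<subseteq> S" "a - 1 \<notin> S" "b + 1 \<notin> S"
      using I by (auto simp: blocks_def)
    have "1 \<le> a" using ab S1 by force
    note block = block_code[OF \<open>1 \<le> a\<close> ab(2-5)[unfolded S_def]]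
    have "\<exists>t. inorder t = [a..<a + (Suc b - a)] \<and> (\<forall>j\<in>{a..<a + (Suc b - a)}. tree_code t j = ?c j)"
      by (rule tree_code_surj) (use block in auto)
    moreover have "a + (Suc b - a) = Suc b" "{a..<Suc b} = I" using ab by auto
    ultimately obtain t where t: "inorder t = [a..<Suc b]" "\<forall>j\<in>I. tree_code t j = ?c j" by metis
    moreover have "set_tree t = I"
      using t(1) \<open>{a..<Suc b} = I\<close> by (metis atLeastLessThan_upt set_inorder)
    moreover have "[a..<Suc b] = sorted_list_of_set I"
      using sorted_list_of_set_range[of a "Suc b"] \<open>{a..<Suc b} = I\<close> by simp
    ultimately show ?thesis by metis
  qed
  then obtain g where g: "\<And>I. I \<in> blocks S \<Longrightarrow> set_tree (g I) = I"
    "\<And>I. I \<in> blocks S \<Longrightarrow> inorder (g I) = sorted_list_of_set I"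
    "\<And>I j. I \<in> blocks S \<Longrightarrow> j \<in> I \<Longrightarrow> tree_code (g I) j = ?c j"
    by metis
  have F: "indexed_forest_on S (g ` blocks S)"
    unfolding indexed_forest_on_def
  proof (intro conjI ballI)
    show "bij_betw set_tree (g ` blocks S) (blocks S)"
      by (rule bij_betw_byWitness[of _ g]) (auto simp: g)
  qed (use finS S1 g in auto)
  have "forest_code (g ` blocks S) i = ?c i" for i
  proof (cases "i \<in> S")
    case True
    then obtain I where I: "I \<in> blocks S" "i \<in> I"
      using Union_blocks[OF finS S1] by blast
    then show ?thesis
      using forest_code_eq_tree_code[OF F, of "g I" i] g by simp
  next
    case False
    \<comment> \<open>Outside the support the witness \<open>a = i\<close> must fail, which forces
      the entry to be 0; the index 0 is covered by the support of \<open>c\<close>.\<close>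
    then have "i = 0 \<or> \<not> Suc i - i \<le> (\<Sum>j=i..i. ?c j)"
      unfolding S_def code_support_def by (cases "i = 0") auto
    then have "?c i = 0" using zero[of 0] by auto
    then show ?thesis using forest_code_notin[OF F False] by simp
  qed
  then have "forest_code (g ` blocks S) = ?c" ..
  with F show ?thesis by blast
qed

lemma forest_of_code:
  assumes "keys c \<subseteq> {1..n}"
  obtains S where "indexed_forest_on S (forest_of c)" "forest_code (forest_of c) = lookup c"
proof -
  obtain S F where F: "indexed_forest_on S F" "forest_code F = lookup c"
    using forest_code_surj[OF assms] by blast
  have "forest_of c = F"
    unfolding forest_of_def indexed_forest_def
  proof (rule the_equality)
    show "(\<exists>S. indexed_forest_on S F) \<and> forest_code F = lookup c" using F by blast
    show "F' = F" if "(\<exists>S. indexed_forest_on S F') \<and> forest_code F' = lookup c" for F'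
      using that F forest_code_inj by metis
  qed
  with F that show thesis by blast
qed

theorem theorem1p5:
  fixes n :: nat and c :: "nat \<Rightarrow>\<^sub>0 nat"
  assumes "n \<ge> 1"
    and "Poly_Mapping.keys c \<subseteq> {1..n}"
  shows "reduction n (forest_poly_code c) =
           (if c \<in> ABB n then forest_poly_code c else 0)"
proof -
  obtain S where F: "indexed_forest_on S (forest_of c)" and code: "forest_code (forest_of c) = lookup c"
    using forest_of_code[OF assms(2)] .
  show ?thesis
    using forest_poly_in_ABB_span[OF F code assms(2)] forest_poly_in_QSym_plus[OF F code assms(2)]
    by (auto simp: forest_poly_code_def QSym_plus_0 intro!: reduction_eqI)
qed

end
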